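(* Let $p>0$ be real and let $B_p=\{(x,y)\in\mathbb{R}^2:|x|^p+|y|^p\le1\}$. For $0\le\lambda\le1$ put $\mu=\mu(\lambda)=\frac{\lambda^p}{1+\lambda^p}$, and let $A'_p$ be the curve parametrized by $$\lambda\mapsto\Big(I_\mu\big(\tfrac1p,1+\tfrac2p\big)-\frac{p\lambda(1+\lambda^p)^{-3/p}}{2B(\frac1p,\frac2p)},\ \ I_\mu\big(\tfrac2p,1+\tfrac1p\big)-\frac{p\lambda^2(1+\lambda^p)^{-3/p}}{B(\frac1p,\frac2p)}-1\Big),\qquad 0\le\lambda\le1.$$ Let $C'_p$ be the union of the images of $A'_p$ under the dihedral group of order eight generated by reflections in the coordinate axes and in the line $y=x$. Then the scaled generalized Jarník polygons $\tilde P_Q(B_p)$ converge to $C'_p$ as $Q\to\infty$: for every $\varepsilon>0$ there is $Q_0(\varepsilon)$ such that for all integers $Q>Q_0(\varepsilon)$, every point of $\tilde P_Q(B_p)$ lies at distance less than $\varepsilon$ from $C'_p$.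
   Context: $B(a,b)=\int_0^1t^{a-1}(1-t)^{b-1}\,dt$ is the Euler beta function, $B_z(a,b)=\int_0^zt^{a-1}(1-t)^{b-1}\,dt$ the incomplete beta function, and $I_z(a,b)=B_z(a,b)/B(a,b)$ the regularized incomplete beta function. For a set $S\subset\mathbb{R}^2$ and a positive integer $Q$, let $V_Q(S)=\{(a,b)\in\mathbb{Z}^2:\gcd(a,b)=1,\ (a/Q,b/Q)\in S\}$. For $S$ symmetric under the dihedral group of order eight, the generalized Jarník polygon $P_Q(S)$ is the convex polygon, unique up to translation, whose edges (as vectors, traversed counterclockwise) are exactly the vectors of $V_Q(S)$; it has eight-fold dihedral symmetry about its center. The scaled polygon $\tilde P_Q(S)$ is obtained by translating $P_Q(S)$ so that its center is the origin and scaling by a positive factor so that the edge corresponding to the vector $(1,0)$ has midpoint $(0,-1)$. Polygons are regarded as closed curves. *)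

theory Defs
  imports "HOL-Analysis.Analysis"
begin

section \<open>Incomplete beta functions\<close>

definition incomplete_beta :: "real \<Rightarrow> real \<Rightarrow> real \<Rightarrow> real" where
  "incomplete_beta z a b = integral {0..z} (\<lambda>t. t powr (a - 1) * (1 - t) powr (b - 1))"

definition regularized_beta :: "real \<Rightarrow> real \<Rightarrow> real \<Rightarrow> real" where
  "regularized_beta z a b = incomplete_beta z a b / Beta a b"


section \<open>The dihedral group of order eight\<close>

inductive_set dihedral8 :: "(real \<times> real \<Rightarrow> real \<times> real) set" where
  ident: "(\<lambda>v. v) \<in> dihedral8"
| flip_x: "g \<in> dihedral8 \<Longrightarrow> (\<lambda>v. (- fst (g v), snd (g v))) \<in> dihedral8"
| flip_y: "g \<in> dihedral8 \<Longrightarrow> (\<lambda>v. (fst (g v), - snd (g v))) \<in> dihedral8"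
| flip_diag: "g \<in> dihedral8 \<Longrightarrow> (\<lambda>v. (snd (g v), fst (g v))) \<in> dihedral8"

definition dihedral_symmetric :: "(real \<times> real) set \<Rightarrow> bool" where
  "dihedral_symmetric P \<longleftrightarrow> (\<forall>g\<in>dihedral8. g ` P = P)"


section \<open>Convex polygons\<close>

text \<open>A polygon is given by the list of its vertices in cyclic order.\<close>

definition vertex :: "(real \<times> real) list \<Rightarrow> nat \<Rightarrow> real \<times> real" where
  "vertex vs i = vs ! (i mod length vs)"

definition edge_vector :: "(real \<times> real) list \<Rightarrow> nat \<Rightarrow> real \<times> real" where
  "edge_vector vs i = vertex vs (Suc i) - vertex vs i"

definition polygon_curve :: "(real \<times> real) list \<Rightarrow> (real \<times> real) set" where
  "polygon_curve vs = (\<Union>i<length vs. closed_segment (vertex vs i) (vertex vs (Suc i)))"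

definition cross2 :: "real \<times> real \<Rightarrow> real \<times> real \<Rightarrow> real" where
  "cross2 u v = fst u * snd v - snd u * fst v"

text \<open>Convex, without straight angles, and traversed counterclockwise: all vertices other than the
  endpoints of an edge lie strictly to the left of the line through that edge.\<close>

definition convex_ccw_polygon :: "(real \<times> real) list \<Rightarrow> bool" where
  "convex_ccw_polygon vs \<longleftrightarrow> 3 \<le> length vs \<and>
     (\<forall>i<length vs. \<forall>j<length vs. j \<noteq> i \<longrightarrow> j \<noteq> Suc i mod length vs \<longrightarrow>
        0 < cross2 (edge_vector vs i) (vertex vs j - vertex vs i))"


section \<open>Generalized Jarnik polygons\<close>

definition primitive_vectors :: "nat \<Rightarrow> (real \<times> real) set \<Rightarrow> (int \<times> int) set" where
  "primitive_vectors Q S =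
     {(a, b). gcd a b = 1 \<and> (real_of_int a / real Q, real_of_int b / real Q) \<in> S}"

definition is_jarnik_polygon :: "nat \<Rightarrow> (real \<times> real) set \<Rightarrow> (real \<times> real) list \<Rightarrow> bool" where
  "is_jarnik_polygon Q S vs \<longleftrightarrow> convex_ccw_polygon vs \<and>
     bij_betw (edge_vector vs) {..<length vs}
       ((\<lambda>(a, b). (real_of_int a, real_of_int b)) ` primitive_vectors Q S)"

text \<open>The polygon is determined only up to translation (and up to the choice of the initial vertex
  in the list), so an arbitrary representative is selected; the normalization in
  \<open>scaled_jarnik_polygon\<close> removes the ambiguity.\<close>

definition jarnik_polygon :: "nat \<Rightarrow> (real \<times> real) set \<Rightarrow> (real \<times> real) list" where
  "jarnik_polygon Q S = (SOME vs. is_jarnik_polygon Q S vs)"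

text \<open>The center is the point \<open>c\<close> about which the curve has the full dihedral symmetry; a bounded
  nonempty set has at most one such point.\<close>

definition scaled_jarnik_polygon :: "nat \<Rightarrow> (real \<times> real) set \<Rightarrow> (real \<times> real) set" where
  "scaled_jarnik_polygon Q S = (let vs = jarnik_polygon Q S in
     THE P. \<exists>c r. 0 < r \<and>
       P = (\<lambda>x. r *\<^sub>R (x - c)) ` polygon_curve vs \<and>
       dihedral_symmetric P \<and>
       (\<exists>i<length vs. edge_vector vs i = (1, 0) \<and>
          r *\<^sub>R (midpoint (vertex vs i) (vertex vs (Suc i)) - c) = (0, - 1)))"


section \<open>The unit ball and the limit curve\<close>

definition p_ball :: "real \<Rightarrow> (real \<times> real) set" where
  "p_ball p = {(x, y). \<bar>x\<bar> powr p + \<bar>y\<bar> powr p \<le> 1}"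

definition limit_arc_point :: "real \<Rightarrow> real \<Rightarrow> real \<times> real" where
  "limit_arc_point p l = (let m = l powr p / (1 + l powr p) in
     (regularized_beta m (1 / p) (1 + 2 / p)
        - p * l * (1 + l powr p) powr (- 3 / p) / (2 * Beta (1 / p) (2 / p)),
      regularized_beta m (2 / p) (1 + 1 / p)
        - p * l\<^sup>2 * (1 + l powr p) powr (- 3 / p) / Beta (1 / p) (2 / p) - 1))"

definition limit_arc :: "real \<Rightarrow> (real \<times> real) set" where
  "limit_arc p = limit_arc_point p ` {0..1}"

definition limit_curve :: "real \<Rightarrow> (real \<times> real) set" where
  "limit_curve p = (\<Union>g\<in>dihedral8. g ` limit_arc p)"

end

theory Submission
  imports Defs
begin

text \<open>
  If \<open>E\<close> is the symmetric set of edges of a convex polygon, then the midpoint of the edge \<open>e\<close>, seen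
  from the center, is half the sum of all edges whose direction lies in the open half-plane to the
  right of \<open>e\<close>. Hence the polygon is an explicit zonogon, visibly invariant under the dihedral
  group, and by symmetry only the edges \<open>e = (\<alpha>, \<beta>)\<close> with \<open>0 \<le> \<beta> \<le> \<alpha>\<close> matter. Going counterclockwise from
  the bottom edge \<open>(1, 0)\<close> to such an edge adds, up to \<open>O(Q)\<close>, all primitive vectors \<open>(a, b)\<close> in the dilated
  ball with \<open>b > 0\<close> and \<open>k b \<le> a\<close>, where \<open>k = \<alpha> / \<beta> = 1 / \<lambda>\<close>.

  The sum of all lattice vectors in this region is \<open>Q\<^sup>3\<close> times a pair of integrals, up to an error
  \<open>O(Q\<^sup>2)\<close> that is uniform in \<open>k\<close>: slice by the coordinate \<open>b\<close> and compare the Riemann sum with the integral.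
  Passing to primitive vectors multiplies the main term by \<open>6 / \<pi>\<^sup>2\<close>, which cancels in the scaling.
  Substituting \<open>u = y\<^sup>p\<close> turns the integrals into incomplete beta functions.
\<close>

section \<open>Convex polygons as zonogons\<close>

text \<open>\<open>scaled_jarnik_polygon\<close> rests on \<open>SOME\<close> and
  \<open>THE\<close>, so before any estimate a convex polygon with the prescribed edges must be
  constructed and its normalization shown to be unique; from then on only the explicit zonogon is
  used. Two features shape the estimates. The parameter \<open>k\<close> ranges over all nonnegative
  reals, and the boundary of the ball, as a graph over \<open>{0..1}\<close>, has unbounded slope
  near 0 if \<open>p < 1\<close> and near 1 if \<open>p > 1\<close>. The factor
  \<open>6 / pi\<^sup>2\<close> arises because a lattice vector is \<open>d\<close> times a
  primitive one: grouping by \<open>d\<close> and dividing by the cube of the dilation gives a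
  series with weights \<open>1 / d\<^sup>2\<close>, whose total is \<open>pi\<^sup>2 / 6\<close>.
  The polygon has size of order \<open>Q ^ 3\<close> and a single edge has length
  \<open>O(Q)\<close>, so half-edge corrections and the position inside an edge disappear in the
  limit.\<close>

lemma cross2_simps:
  "cross2 (u + v) w = cross2 u w + cross2 v w" "cross2 w (u + v) = cross2 w u + cross2 w v"
  "cross2 (u - v) w = cross2 u w - cross2 v w" "cross2 w (u - v) = cross2 w u - cross2 w v"
  "cross2 (- u) w = - cross2 u w" "cross2 w (- u) = - cross2 w u"
  "cross2 (c *\<^sub>R u) w = c * cross2 u w" "cross2 w (c *\<^sub>R u) = c * cross2 w u"
  "cross2 u u = 0" "cross2 0 w = 0" "cross2 w 0 = 0"
  by (simp_all add: cross2_def algebra_simps)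

lemma cross2_commute: "cross2 u v = - cross2 v u"
  by (simp add: cross2_def)

lemma cross2_sum: "cross2 u (sum f A) = (\<Sum>x\<in>A. cross2 u (f x))"
  by (induction A rule: infinite_finite_induct) (auto simp: cross2_simps)

text \<open>The two positive cross products put \<open>f\<close> in the open cone spanned by
  \<open>e\<close> and \<open>e'\<close>, which is narrower than a half turn. So \<open>e'\<close>
  is the next direction counterclockwise after \<open>e\<close>, expressed without angles.\<close>

definition adjacent_in :: "(real \<times> real) set \<Rightarrow> real \<times> real \<Rightarrow> real \<times> real \<Rightarrow> bool" where
  "adjacent_in E e e' \<longleftrightarrow> 0 < cross2 e e' \<and> (\<forall>f\<in>E. \<not> (0 < cross2 e f \<and> 0 < cross2 f e'))"

lemma vertex_Suc: "vertex vs (Suc i) = vertex vs i + edge_vector vs i"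
  by (simp add: edge_vector_def)

lemma vertex_mod: "vertex vs (i mod length vs) = vertex vs i"
  by (simp add: vertex_def)

text \<open>At both endpoints of the edge the cross product vanishes, so the strict inequality of
  the definition extends to a weak one over all vertices, with a known equality case.\<close>

lemma convex_ccw_polygon_left:
  assumes "convex_ccw_polygon vs" "i < length vs" "j < length vs"
  shows "0 \<le> cross2 (edge_vector vs i) (vertex vs j - vertex vs i)"
    and "cross2 (edge_vector vs i) (vertex vs j - vertex vs i) = 0 \<Longrightarrow>
           j = i \<or> j = Suc i mod length vs"
proof -
  have "cross2 (edge_vector vs i) (vertex vs j - vertex vs i) = 0"
    if "j = i \<or> j = Suc i mod length vs"
    using that
  proof
    assume "j = Suc i mod length vs"
    then have "vertex vs j = vertex vs (Suc i)" by (simp add: vertex_mod)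
    then show ?thesis by (simp add: vertex_Suc cross2_simps)
  qed (simp add: cross2_simps)
  moreover have "0 < cross2 (edge_vector vs i) (vertex vs j - vertex vs i)"
    if "\<not> (j = i \<or> j = Suc i mod length vs)"
    using assms that unfolding convex_ccw_polygon_def by blast
  ultimately show "0 \<le> cross2 (edge_vector vs i) (vertex vs j - vertex vs i)"
    and "cross2 (edge_vector vs i) (vertex vs j - vertex vs i) = 0 \<Longrightarrow>
           j = i \<or> j = Suc i mod length vs"
    by (cases "j = i \<or> j = Suc i mod length vs"; force)+
qed

text \<open>An edge direction strictly between two consecutive ones would have its supporting line
  through the common vertex \<open>w\<close> of these two edges only.\<close>

lemma convex_ccw_polygon_adjacent:
  assumes conv: "convex_ccw_polygon vs" and i: "i < length vs"
  shows "adjacent_in (edge_vector vs ` {..<length vs}) (edge_vector vs i)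
           (edge_vector vs (Suc i mod length vs))"
proof -
  define n where "n = length vs"
  define i' where "i' = Suc i mod n"
  define i'' where "i'' = Suc i' mod n"
  have n: "3 \<le> n" using conv by (simp add: convex_ccw_polygon_def n_def)
  have i'n: "i' < n" and i''n: "i'' < n" using n by (auto simp: i'_def i''_def)
  define w where "w = vertex vs i'"
  have w: "w = vertex vs i + edge_vector vs i"
    using vertex_mod[of vs "Suc i"] by (simp add: w_def i'_def n_def vertex_Suc)
  have "vertex vs i'' = vertex vs i' + edge_vector vs i'"
    using vertex_mod[of vs "Suc i'"] by (simp add: i''_def n_def vertex_Suc)
  then have "cross2 (edge_vector vs i) (edge_vector vs i')
      = cross2 (edge_vector vs i) (vertex vs i'' - vertex vs i)"
    using w by (simp add: w_def cross2_simps)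
  moreover have "i'' \<noteq> i" "i'' \<noteq> i'"
    using n i by (auto simp: i''_def i'_def n_def mod_Suc split: if_splits)
  then have "0 < cross2 (edge_vector vs i) (vertex vs i'' - vertex vs i)"
    using conv i i''n unfolding convex_ccw_polygon_def i'_def n_def by blast
  ultimately have D: "0 < cross2 (edge_vector vs i) (edge_vector vs i')" by simp
  have False if k: "k < n" and A: "0 < cross2 (edge_vector vs i) (edge_vector vs k)"
    and B: "0 < cross2 (edge_vector vs k) (edge_vector vs i')" for k
  proof -
    have left_i: "cross2 (edge_vector vs i) (w - vertex vs k) \<le> 0"
      using convex_ccw_polygon_left(1)[OF conv i, of k] k w by (simp add: cross2_simps n_def)
    have left_i': "cross2 (edge_vector vs i') (w - vertex vs k) \<le> 0"
      using convex_ccw_polygon_left(1)[OF conv, of i' k] k i'n by (simp add: cross2_simps n_def w_def)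
    have left_k: "0 \<le> cross2 (edge_vector vs k) (w - vertex vs k)"
      using convex_ccw_polygon_left(1)[OF conv, of k i'] k i'n by (simp add: n_def w_def)
    \<comment> \<open>The Pluecker relation for three edge vectors and
      \<open>w - vertex vs k\<close>: edge \<open>k\<close> is a positive combination of edges
      \<open>i\<close> and \<open>i'\<close>. The left side is nonnegative and both terms on the
      right are nonpositive, so all of them vanish.\<close>
    have "cross2 (edge_vector vs i) (edge_vector vs i') * cross2 (edge_vector vs k) (w - vertex vs k)
      = cross2 (edge_vector vs k) (edge_vector vs i') * cross2 (edge_vector vs i) (w - vertex vs k)
      + cross2 (edge_vector vs i) (edge_vector vs k) * cross2 (edge_vector vs i') (w - vertex vs k)"
      by (simp add: cross2_def algebra_simps)
    moreover have "0 \<le> cross2 (edge_vector vs i) (edge_vector vs i') * cross2 (edge_vector vs k) (w - vertex vs k)"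
      using D left_k by simp
    moreover have "cross2 (edge_vector vs k) (edge_vector vs i') * cross2 (edge_vector vs i) (w - vertex vs k) \<le> 0"
      using B left_i by (simp add: mult_le_0_iff)
    moreover have "cross2 (edge_vector vs i) (edge_vector vs k) * cross2 (edge_vector vs i') (w - vertex vs k) \<le> 0"
      using A left_i' by (simp add: mult_le_0_iff)
    ultimately have "cross2 (edge_vector vs k) (edge_vector vs i') * cross2 (edge_vector vs i) (w - vertex vs k) = 0"
      by linarith
    then have "cross2 (edge_vector vs i) (w - vertex vs k) = 0" using B by simp
    then have "cross2 (edge_vector vs i) (vertex vs k - vertex vs i) = 0"
      using w by (simp add: cross2_simps)
    then have "k = i \<or> k = i'"
      using convex_ccw_polygon_left(2)[OF conv i, of k] k by (simp add: n_def i'_def)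
    then show False using A B by (auto simp: cross2_simps)
  qed
  then show ?thesis
    using D unfolding adjacent_in_def i'_def n_def by blast
qed

text \<open>For a symmetric edge set, the walk from the midpoint of \<open>e\<close> to that of
  \<open>- e\<close> adds up exactly the edges to the left of \<open>e\<close> (the two half edges
  cancel). These midpoints are opposite through the center, so the midpoint of \<open>e\<close> is
  minus half that sum; negating the edges turns left into right.\<close>

definition edge_mid :: "(real \<times> real) set \<Rightarrow> real \<times> real \<Rightarrow> real \<times> real" where
  "edge_mid E e = (1/2) *\<^sub>R (\<Sum>f | f \<in> E \<and> 0 < cross2 f e. f)"

definition zonogon_edge :: "(real \<times> real) set \<Rightarrow> real \<times> real \<Rightarrow> (real \<times> real) set" where
  "zonogon_edge E e = closed_segment (edge_mid E e - (1/2) *\<^sub>R e) (edge_mid E e + (1/2) *\<^sub>R e)"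

definition zonogon :: "(real \<times> real) set \<Rightarrow> (real \<times> real) set" where
  "zonogon E = (\<Union>e\<in>E. zonogon_edge E e)"

text \<open>Everything about the polygon that does not involve the shape of the ball. The assumption
  \<open>parallel\<close> is what primitivity provides: each ray carries at most one edge, as
  required in a convex polygon without straight angles.\<close>

locale edge_star =
  fixes E :: "(real \<times> real) set"
  assumes finite_E: "finite E"
    and flip_x_E: "(x, y) \<in> E \<Longrightarrow> (- x, y) \<in> E"
    and flip_y_E: "(x, y) \<in> E \<Longrightarrow> (x, - y) \<in> E"
    and flip_diag_E: "(x, y) \<in> E \<Longrightarrow> (y, x) \<in> E"
    and parallel: "\<lbrakk>e \<in> E; f \<in> E; cross2 e f = 0\<rbrakk> \<Longrightarrow> f = e \<or> f = - e"
    and zero_notin: "(0, 0) \<notin> E"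
    and unit_E: "(1, 0) \<in> E"
begin

lemma uminus_E: "e \<in> E \<Longrightarrow> - e \<in> E"
  using flip_x_E[of "fst e" "- snd e"] flip_y_E[of "fst e" "snd e"] by (cases e) auto

lemma nonzero_E: "e \<in> E \<Longrightarrow> e \<noteq> 0"
  using zero_notin by (auto simp: zero_prod_def)

text \<open>When the half-plane to the right of \<open>e\<close> turns on to that of the next
  direction \<open>e'\<close>, the only edge gained is \<open>e\<close> and the only edge lost is
  \<open>- e'\<close>. The full sum changes by \<open>e + e'\<close>, so the end of one zonogon edge
  is the start of the next.\<close>

lemma edge_mid_step:
  assumes "e \<in> E" "e' \<in> E" and adj: "adjacent_in E e e'"
  shows "edge_mid E e + (1/2) *\<^sub>R e = edge_mid E e' - (1/2) *\<^sub>R e'"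
proof -
  define A where "A = {f \<in> E. 0 < cross2 f e}"
  define A' where "A' = {f \<in> E. 0 < cross2 f e'}"
  have fin: "finite A" "finite A'" using finite_E by (auto simp: A_def A'_def)
  have pos: "0 < cross2 e e'" and none: "\<And>f. f \<in> E \<Longrightarrow> 0 < cross2 e f \<Longrightarrow> \<not> 0 < cross2 f e'"
    using adj by (auto simp: adjacent_in_def)
  have "f = e" if f: "f \<in> E" "0 < cross2 f e'" "\<not> 0 < cross2 f e" for f
  proof -
    have "\<not> 0 < cross2 e f" using none f by blast
    then have "cross2 e f = 0" using f(3) cross2_commute[of e f] by linarith
    then show ?thesis using parallel[of e f] f assms pos by (auto simp: cross2_simps)
  qed
  then have A'A: "A' - A = {e}" using assms pos by (auto simp: A_def A'_def cross2_simps)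
  have "f = - e'" if f: "f \<in> E" "0 < cross2 f e" "\<not> 0 < cross2 f e'" for f
  proof -
    have "0 < cross2 e (- f)" using f cross2_commute[of e f] by (simp add: cross2_simps)
    then have "\<not> 0 < cross2 (- f) e'" using none uminus_E f by blast
    then have "cross2 e' f = 0" using f(3) cross2_commute[of e' f] by (simp add: cross2_simps)
    then show ?thesis using parallel[of e' f] f assms pos cross2_commute[of e' e] by auto
  qed
  moreover have "0 < cross2 (- e') e" "\<not> 0 < cross2 (- e') e'"
    using pos cross2_commute[of e e'] by (simp_all add: cross2_simps)
  ultimately have AA': "A - A' = {- e'}"
    using uminus_E[OF assms(2)] unfolding A_def A'_def by blast
  have "sum (\<lambda>f. f) A = sum (\<lambda>f. f) (A \<inter> A') + (- e')"
    using sum.Int_Diff[OF fin(1), of "\<lambda>f. f" A'] AA' by simp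
  moreover have "sum (\<lambda>f. f) A' = sum (\<lambda>f. f) (A \<inter> A') + e"
    using sum.Int_Diff[OF fin(2), of "\<lambda>f. f" A] A'A by (simp add: Int_commute)
  ultimately have "sum (\<lambda>f. f) A' = sum (\<lambda>f. f) A + e' + e" by simp
  then show ?thesis unfolding edge_mid_def A_def[symmetric] A'_def[symmetric]
    by (simp add: algebra_simps flip: scaleR_add_right)
qed

end

definition has_edges :: "(real \<times> real) set \<Rightarrow> (real \<times> real) list \<Rightarrow> bool" where
  "has_edges E vs \<longleftrightarrow> convex_ccw_polygon vs \<and> bij_betw (edge_vector vs) {..<length vs} E"

context edge_star
begin

text \<open>Consecutive edges of a convex polygon are adjacent directions, so
  \<open>edge_mid_step\<close> follows the vertices around the polygon. This makes every polygon
  with edge set \<open>E\<close> a translate of the same zonogon, whichever vertex the list starts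
  with.\<close>

lemma has_edges_zonogon:
  assumes "has_edges E vs"
  obtains c where "polygon_curve vs = (+) c ` zonogon E"
    and "\<And>i. i < length vs \<Longrightarrow>
           midpoint (vertex vs i) (vertex vs (Suc i)) = c + edge_mid E (edge_vector vs i)"
proof -
  define ev where "ev i = edge_vector vs i" for i
  define n where "n = length vs"
  have conv: "convex_ccw_polygon vs" and bij: "bij_betw ev {..<n} E"
    using assms by (auto simp: has_edges_def ev_def[abs_def] n_def)
  have n: "3 \<le> n" using conv by (simp add: convex_ccw_polygon_def n_def)
  have img: "ev ` {..<n} = E" using bij by (simp add: bij_betw_def)
  \<comment> \<open>The translation that places vertex 0 at the start of its zonogon edge; the
    induction carries this over to all other vertices.\<close>
  define c where "c = vertex vs 0 - (edge_mid E (ev 0) - (1/2) *\<^sub>R ev 0)"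
  have v: "vertex vs i = c + (edge_mid E (ev i) - (1/2) *\<^sub>R ev i)" if "i < n" for i
    using that
  proof (induction i)
    case (Suc i)
    have "adjacent_in E (ev i) (ev (Suc i))"
      using convex_ccw_polygon_adjacent[OF conv, of i] Suc.prems img
      by (simp add: n_def ev_def[abs_def])
    then have "edge_mid E (ev i) + (1/2) *\<^sub>R ev i = edge_mid E (ev (Suc i)) - (1/2) *\<^sub>R ev (Suc i)"
      using edge_mid_step[of "ev i" "ev (Suc i)"] img Suc.prems by (simp add: image_iff) force
    then have "vertex vs (Suc i) = vertex vs i + ev i
        + ((edge_mid E (ev (Suc i)) - (1/2) *\<^sub>R ev (Suc i)) - (edge_mid E (ev i) + (1/2) *\<^sub>R ev i))"
      by (simp add: vertex_Suc ev_def)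
    also have "\<dots> = (vertex vs i - (edge_mid E (ev i) - (1/2) *\<^sub>R ev i))
       + (ev i - (1/2) *\<^sub>R ev i - (1/2) *\<^sub>R ev i) + (edge_mid E (ev (Suc i)) - (1/2) *\<^sub>R ev (Suc i))"
      by (simp add: algebra_simps)
    also have "ev i - (1/2) *\<^sub>R ev i - (1/2) *\<^sub>R ev i = 0"
      by (simp add: algebra_simps flip: scaleR_add_left)
    finally show ?case using Suc by simp
  qed (simp add: c_def)
  have v': "vertex vs (Suc i) = c + (edge_mid E (ev i) + (1/2) *\<^sub>R ev i)" if "i < n" for i
    using v[OF that] by (simp add: vertex_Suc ev_def prod_eq_iff)
  have "closed_segment (vertex vs i) (vertex vs (Suc i)) = (+) c ` zonogon_edge E (ev i)"
    if "i < n" for i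
    using v[OF that] v'[OF that] by (simp add: zonogon_edge_def closed_segment_translation)
  then have "polygon_curve vs = (\<Union>i<n. (+) c ` zonogon_edge E (ev i))"
    by (simp add: polygon_curve_def n_def)
  also have "\<dots> = (+) c ` zonogon E"
    using img by (auto simp: zonogon_def image_UN)
  finally have "polygon_curve vs = (+) c ` zonogon E" .
  moreover have "midpoint (vertex vs i) (vertex vs (Suc i)) = c + edge_mid E (ev i)" if "i < n" for i
    using v[OF that] v'[OF that] by (simp add: midpoint_def prod_eq_iff)
  ultimately show ?thesis using that unfolding ev_def n_def by blast
qed

text \<open>A reflection reverses orientation: it carries the half-plane to the right of
  \<open>e\<close> to the one to the left of \<open>\<phi> e\<close>, which is the one to the right
  of \<open>- \<phi> e\<close>. Hence the minus sign in the action on edges.\<close>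

lemma reflection_zonogon_edge:
  assumes lin: "linear \<phi>" and invol: "\<And>v. \<phi> (\<phi> v) = v" and E: "\<And>f. f \<in> E \<Longrightarrow> \<phi> f \<in> E"
    and neg: "\<And>u v. cross2 (\<phi> u) (\<phi> v) = - cross2 u v"
  shows "edge_mid E (- \<phi> e) = \<phi> (edge_mid E e)"
    and "\<phi> ` zonogon_edge E e = zonogon_edge E (- \<phi> e)"
    and "\<phi> ` zonogon E = zonogon E"
proof -
  have mid: "edge_mid E (- \<phi> e) = \<phi> (edge_mid E e)" for e
  proof -
    have "{f \<in> E. 0 < cross2 f (- \<phi> e)} = \<phi> ` {f \<in> E. 0 < cross2 f e}"
    proof (intro equalityI subsetI)
      fix f assume f: "f \<in> {f \<in> E. 0 < cross2 f (- \<phi> e)}"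
      then have "0 < cross2 (\<phi> f) e" using neg[of f "\<phi> e"] by (simp add: cross2_simps invol)
      then have "\<phi> f \<in> {f \<in> E. 0 < cross2 f e}" using f E by simp
      then show "f \<in> \<phi> ` {f \<in> E. 0 < cross2 f e}" by (metis imageI invol)
    qed (auto simp: cross2_simps neg intro: E simp del: split_paired_All)
    moreover have "inj_on \<phi> A" for A by (metis inj_on_inverseI invol)
    ultimately show ?thesis
      using lin by (simp add: edge_mid_def sum.reindex linear_cmul linear_sum)
  qed
  then show "edge_mid E (- \<phi> e) = \<phi> (edge_mid E e)" .
  have seg: "\<phi> ` zonogon_edge E e = zonogon_edge E (- \<phi> e)" for e
    unfolding zonogon_edge_def mid closed_segment_linear_image[OF lin, symmetric]
    using lin by (simp add: linear_add linear_diff linear_cmul closed_segment_commute)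
  then show "\<phi> ` zonogon_edge E e = zonogon_edge E (- \<phi> e)" .
  have "(\<lambda>e. - \<phi> e) ` E = E"
  proof (intro equalityI subsetI)
    fix f assume "f \<in> E"
    then have "\<phi> (- f) \<in> E" using E uminus_E by blast
    then have "- \<phi> (\<phi> (- f)) \<in> (\<lambda>e. - \<phi> e) ` E" by blast
    then show "f \<in> (\<lambda>e. - \<phi> e) ` E" by (simp add: invol)
  qed (use E uminus_E in blast)
  then show "\<phi> ` zonogon E = zonogon E"
    unfolding zonogon_def image_UN seg by (metis image_image)
qed

lemma flip_x_zonogon:
  "edge_mid E (fst e, - snd e) = (- fst (edge_mid E e), snd (edge_mid E e))"
  "(\<lambda>v. (- fst v, snd v)) ` zonogon_edge E e = zonogon_edge E (fst e, - snd e)"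
  "(\<lambda>v. (- fst v, snd v)) ` zonogon E = zonogon E"
proof -
  let ?\<phi> = "\<lambda>v::real \<times> real. (- fst v, snd v)"
  have r: "linear ?\<phi>" "\<And>v. ?\<phi> (?\<phi> v) = v" "\<And>f. f \<in> E \<Longrightarrow> ?\<phi> f \<in> E"
    "\<And>u v. cross2 (?\<phi> u) (?\<phi> v) = - cross2 u v"
    using flip_x_E flip_y_E flip_diag_E by (auto intro!: linearI simp: cross2_def)
  show
    "edge_mid E (fst e, - snd e) = (- fst (edge_mid E e), snd (edge_mid E e))"
    "(\<lambda>v. (- fst v, snd v)) ` zonogon_edge E e = zonogon_edge E (fst e, - snd e)"
    "(\<lambda>v. (- fst v, snd v)) ` zonogon E = zonogon E"
    using reflection_zonogon_edge[OF r] by simp_all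
qed

lemma flip_y_zonogon:
  "(\<lambda>v. (fst v, - snd v)) ` zonogon_edge E e = zonogon_edge E (- fst e, snd e)"
  "(\<lambda>v. (fst v, - snd v)) ` zonogon E = zonogon E"
proof -
  let ?\<phi> = "\<lambda>v::real \<times> real. (fst v, - snd v)"
  have r: "linear ?\<phi>" "\<And>v. ?\<phi> (?\<phi> v) = v" "\<And>f. f \<in> E \<Longrightarrow> ?\<phi> f \<in> E"
    "\<And>u v. cross2 (?\<phi> u) (?\<phi> v) = - cross2 u v"
    using flip_x_E flip_y_E flip_diag_E by (auto intro!: linearI simp: cross2_def)
  show
    "(\<lambda>v. (fst v, - snd v)) ` zonogon_edge E e = zonogon_edge E (- fst e, snd e)"
    "(\<lambda>v. (fst v, - snd v)) ` zonogon E = zonogon E"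
    using reflection_zonogon_edge[OF r] by simp_all
qed

lemma flip_diag_zonogon:
  "(\<lambda>v. (snd v, fst v)) ` zonogon_edge E e = zonogon_edge E (- snd e, - fst e)"
  "(\<lambda>v. (snd v, fst v)) ` zonogon E = zonogon E"
proof -
  let ?\<phi> = "\<lambda>v::real \<times> real. (snd v, fst v)"
  have r: "linear ?\<phi>" "\<And>v. ?\<phi> (?\<phi> v) = v" "\<And>f. f \<in> E \<Longrightarrow> ?\<phi> f \<in> E"
    "\<And>u v. cross2 (?\<phi> u) (?\<phi> v) = - cross2 u v"
    using flip_x_E flip_y_E flip_diag_E by (auto intro!: linearI simp: cross2_def)
  show
    "(\<lambda>v. (snd v, fst v)) ` zonogon_edge E e = zonogon_edge E (- snd e, - fst e)"
    "(\<lambda>v. (snd v, fst v)) ` zonogon E = zonogon E"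
    using reflection_zonogon_edge[OF r] by simp_all
qed

text \<open>Changing the sign of the first coordinate maps the bottom edge to itself, so its
  midpoint lies on the vertical axis below the center. Minus its second coordinate is the divisor
  that the normalization to \<open>(0, - 1)\<close> requires.\<close>

lemma edge_mid_unit:
  "fst (edge_mid E (1, 0)) = 0"
  "- snd (edge_mid E (1, 0)) = (1/2) * (\<Sum>f | f \<in> E \<and> 0 < snd f. snd f)"
  "snd (edge_mid E (1, 0)) < 0"
proof -
  have "edge_mid E (1, 0) = (- fst (edge_mid E (1, 0)), snd (edge_mid E (1, 0)))"
    using flip_x_zonogon(1)[of "(1, 0)"] by simp
  then show "fst (edge_mid E (1, 0)) = 0" by (metis fst_conv neg_equal_zero)
  have "(\<Sum>f | f \<in> E \<and> 0 < snd f. snd f) = (\<Sum>f | f \<in> E \<and> 0 < - snd f. - snd f)"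
    using uminus_E by (intro sum.reindex_bij_witness[of _ uminus uminus]) auto
  then show *: "- snd (edge_mid E (1, 0)) = (1/2) * (\<Sum>f | f \<in> E \<and> 0 < snd f. snd f)"
    by (simp add: edge_mid_def snd_sum cross2_def sum_negf)
  have "(0, 1) \<in> E" using flip_diag_E[OF unit_E] .
  then have "0 < (\<Sum>f | f \<in> E \<and> 0 < snd f. snd f)"
    using finite_E by (intro sum_pos2[of _ "(0, 1)"]) auto
  then show "snd (edge_mid E (1, 0)) < 0" using * by linarith
qed

section \<open>Existence of the polygon\<close>

text \<open>This is the convexity condition for the list of zonogon vertices; \<open>g\<close> is
  the edge before \<open>e'\<close>, so that \<open>g \<noteq> e\<close> and
  \<open>e' \<noteq> e\<close> exclude exactly the two endpoints of \<open>e\<close>. The difference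
  of two start vertices is half a sum of edges weakly to the left of \<open>e\<close> minus half a
  sum of edges weakly to the right; strictness needs a single edge off the line of
  \<open>e\<close>.\<close>

lemma start_vertex_support:
  assumes "e \<in> E" "e' \<in> E" "g \<in> E" and adj: "adjacent_in E g e'" and "e' \<noteq> e" "g \<noteq> e"
  shows "0 < cross2 e ((edge_mid E e' - (1/2) *\<^sub>R e') - (edge_mid E e - (1/2) *\<^sub>R e))"
proof -
  \<comment> \<open>Adjoining \<open>- e\<close> to the half-plane absorbs the term
    \<open>- (1/2) *\<^sub>R e\<close>, so the start vertex is exactly half the sum over
    \<open>A e\<close>.\<close>
  define A where "A e = {f \<in> E. 0 < cross2 f e \<or> f = - e}" for e
  have fin: "finite (A e)" for e using finite_E by (auto simp: A_def)
  have vert: "edge_mid E e - (1/2) *\<^sub>R e = (1/2) *\<^sub>R \<Sum>(A e)" if "e \<in> E" for e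
  proof -
    have "A e = insert (- e) {f \<in> E. 0 < cross2 f e}"
      using uminus_E[OF that] by (auto simp: A_def)
    then have "\<Sum>(A e) = - e + \<Sum>{f \<in> E. 0 < cross2 f e}"
      using finite_E by (simp add: cross2_simps)
    then show ?thesis by (simp add: edge_mid_def scaleR_diff_right scaleR_right_diff_distrib)
  qed
  have "\<Sum>(A e') = \<Sum>(A e' \<inter> A e) + \<Sum>(A e' - A e)" "\<Sum>(A e) = \<Sum>(A e' \<inter> A e) + \<Sum>(A e - A e')"
    using sum.Int_Diff[OF fin] by (metis Int_commute)+
  then have "(edge_mid E e' - (1/2) *\<^sub>R e') - (edge_mid E e - (1/2) *\<^sub>R e)
      = (1/2) *\<^sub>R (\<Sum>(A e' - A e) - \<Sum>(A e - A e'))"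
    using assms by (simp add: vert algebra_simps)
  then have eq: "cross2 e ((edge_mid E e' - (1/2) *\<^sub>R e') - (edge_mid E e - (1/2) *\<^sub>R e))
      = (1/2) * ((\<Sum>f\<in>A e' - A e. cross2 e f) + (\<Sum>f\<in>A e - A e'. - cross2 e f))"
    by (simp add: cross2_simps cross2_sum sum_negf)
  have nonneg: "0 \<le> cross2 e f" if "f \<in> A e' - A e" for f
    using that cross2_commute[of e f] by (auto simp: A_def)
  have "0 \<le> - cross2 e f" if "f \<in> A e - A e'" for f
    using that cross2_commute[of e f] by (auto simp: A_def cross2_simps)
  then have nonneg2: "0 \<le> (\<Sum>f\<in>A e - A e'. - cross2 e f)" by (intro sum_nonneg)
  have pos: "0 < cross2 g e'" and none: "\<not> (0 < cross2 g e \<and> 0 < cross2 e e')"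
    using adj assms by (auto simp: adjacent_in_def)
  \<comment> \<open>The candidates are \<open>- e'\<close> and \<open>g\<close>. If neither is
    strictly to the left of \<open>e\<close>, then \<open>e\<close> lies weakly between
    \<open>g\<close> and \<open>e'\<close>; adjacency leaves only \<open>e\<close> opposite to one
    of them, and that contradicts \<open>0 < cross2 g e'\<close>.\<close>
  have "\<exists>f\<in>A e'. 0 < cross2 e f"
  proof (rule ccontr)
    assume no: "\<not> ?thesis"
    have "- e' \<in> A e'" "g \<in> A e'" using assms pos uminus_E by (auto simp: A_def)
    then have 1: "0 \<le> cross2 e e'" and 2: "0 \<le> cross2 g e"
      using no cross2_commute[of g e] by (auto simp: cross2_simps not_less)
    have "cross2 e e' = 0 \<or> cross2 g e = 0" using none 1 2 by linarith
    then have "e' = - e \<or> g = - e"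
      using parallel[of e e'] parallel[of e g] cross2_commute[of g e] assms by auto
    then show False
    proof
      assume "e' = - e"
      then show False using pos 2 by (simp add: cross2_simps)
    next
      assume "g = - e"
      then show False using pos 1 by (simp add: cross2_simps)
    qed
  qed
  then obtain f where f: "f \<in> A e'" "0 < cross2 e f" by blast
  then have "f \<notin> A e" using cross2_commute[of e f] by (auto simp: A_def cross2_simps)
  then have "0 < (\<Sum>f\<in>A e' - A e. cross2 e f)"
    using f fin nonneg by (intro sum_pos2[of _ f]) auto
  then show ?thesis unfolding eq using nonneg2 by simp
qed

end

section \<open>Angular order of the edges\<close>

lemma sin_pos_iff:
  assumes "- 2 * pi < d" "d < 2 * pi"
  shows "0 < sin d \<longleftrightarrow> (0 < d \<and> d < pi) \<or> d < - pi"
proof -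
  consider "d < - pi" | "- pi \<le> d" "d \<le> 0" | "0 < d" "d < pi" | "pi \<le> d" by linarith
  then show ?thesis
  proof cases
    case 1
    then have "0 < sin (d + 2 * pi)" using assms by (intro sin_gt_zero) auto
    then show ?thesis using 1 by simp
  next
    case 2
    then have "0 \<le> sin (- d)" by (intro sin_ge_zero) auto
    then show ?thesis using 2 by simp
  next
    case 3
    then show ?thesis by (simp add: sin_gt_zero)
  next
    case 4
    then have "sin d \<le> 0" using assms by (intro sin_le_zero) auto
    then show ?thesis using 4 pi_gt_zero by linarith
  qed
qed

text \<open>Angles are taken in \<open>[0, 2 pi)\<close>, so their differences fill
  \<open>(- 2 pi, 2 pi)\<close>. That is the range of \<open>sin_pos_iff\<close>, whose case
  \<open>d < - pi\<close> is the passage across the positive horizontal axis.\<close>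

definition direction_angle :: "real \<times> real \<Rightarrow> real" where
  "direction_angle e = Arg2pi (Complex (fst e) (snd e))"

lemma direction_angle_bounds: "0 \<le> direction_angle e" "direction_angle e < 2 * pi"
  by (auto simp: direction_angle_def Arg2pi_ge_0 Arg2pi_lt_2pi)

lemma cross2_eq_sin:
  "cross2 e f = norm e * norm f * sin (direction_angle f - direction_angle e)"
proof -
  have "norm e * cos (direction_angle e) = fst e" "norm e * sin (direction_angle e) = snd e" for e :: "real \<times> real"
    using cos_Arg2pi[of "Complex (fst e) (snd e)"] sin_Arg2pi[of "Complex (fst e) (snd e)"]
    by (simp_all add: direction_angle_def norm_prod_def complex_norm)
  moreover have "norm e * norm f * sin (direction_angle f - direction_angle e)
      = (norm e * cos (direction_angle e)) * (norm f * sin (direction_angle f))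
        - (norm e * sin (direction_angle e)) * (norm f * cos (direction_angle f))"
    by (simp add: sin_diff algebra_simps)
  ultimately show ?thesis by (simp only: cross2_def)
qed

lemma cross2_pos_iff_angle:
  assumes "e \<noteq> 0" "f \<noteq> 0"
  shows "0 < cross2 e f \<longleftrightarrow>
    (0 < direction_angle f - direction_angle e \<and> direction_angle f - direction_angle e < pi)
      \<or> direction_angle f - direction_angle e < - pi"
proof -
  have "0 < cross2 e f \<longleftrightarrow> 0 < sin (direction_angle f - direction_angle e)"
    unfolding cross2_eq_sin using assms zero_less_norm_iff[of e] zero_less_norm_iff[of f]
    by (metis mult_pos_pos zero_less_mult_pos)
  then show ?thesis
    using direction_angle_bounds[of e] direction_angle_bounds[of f] by (simp add: sin_pos_iff)
qed

context edge_star
begin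

text \<open>The edges are sorted by angle, which is injective on \<open>E\<close> because of
  \<open>parallel\<close>. Sorting alone does not give adjacency: a gap of at least
  \<open>pi\<close> must be ruled out, and the last edge must be matched with the first one.\<close>

lemma exists_cyclic_enumeration:
  obtains es where "distinct es" "set es = E" "3 \<le> length es"
    "\<And>i. i < length es \<Longrightarrow> adjacent_in E (es ! i) (es ! (Suc i mod length es))"
proof -
  obtain xs where xs: "set xs = E" "distinct xs" using finite_distinct_list[OF finite_E] by blast
  define es where "es = sort_key direction_angle xs"
  define n where "n = length es"
  define a where "a i = direction_angle (es ! i)" for i
  have es: "set es = E" "distinct es" using xs by (auto simp: es_def)
  have in_E: "es ! i \<in> E" if "i < n" for i using that es by (auto simp: n_def)
  have ex_index: "\<exists>k<n. es ! k = f" if "f \<in> E" for f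
    using that es by (metis in_set_conv_nth n_def)
  have ab: "0 \<le> a i" "a i < 2 * pi" for i by (auto simp: a_def direction_angle_bounds)
  have units: "(1, 0) \<in> E" "(- 1, 0) \<in> E" "(0, 1) \<in> E" "(0, - 1) \<in> E"
    using unit_E flip_x_E flip_y_E flip_diag_E by auto
  have "card {(1, 0), (- 1, 0), (0, 1) :: real \<times> real} \<le> card E"
    using units finite_E by (intro card_mono) auto
  then have n3: "3 \<le> n" using es distinct_card[of es] by (simp add: n_def)
  have cross_iff: "0 < cross2 (es ! i) (es ! j) \<longleftrightarrow> (0 < a j - a i \<and> a j - a i < pi) \<or> a j - a i < - pi"
    if "i < n" "j < n" for i j
    unfolding a_def using cross2_pos_iff_angle in_E nonzero_E that by blast
  have inj: "i = j" if "i < n" "j < n" "a i = a j" for i j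
  proof -
    have "cross2 (es ! i) (es ! j) = 0" using that by (simp add: cross2_eq_sin a_def)
    then have "es ! j = es ! i \<or> es ! j = - (es ! i)" using parallel in_E that by blast
    moreover have "es ! j \<noteq> - (es ! i)"
    proof
      assume neg: "es ! j = - (es ! i)"
      define z where "z = Complex (fst (es ! i)) (snd (es ! i))"
      have "z \<noteq> 0" using nonzero_E in_E \<open>i < n\<close> by (auto simp: z_def complex_eq_iff prod_eq_iff)
      moreover have "Arg2pi (- z) = Arg2pi z"
        using \<open>a i = a j\<close> neg by (simp add: a_def direction_angle_def z_def complex_eq_iff)
          (metis complex_minus)
      ultimately show False using Arg2pi_minus[of z] pi_gt_zero by (auto split: if_splits)
    qed
    ultimately have "es ! i = es ! j" by simp
    then show ?thesis using es that by (simp add: nth_eq_iff_index_eq n_def)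
  qed
  have le: "a i \<le> a j" if "i \<le> j" "j < n" for i j
    using sorted_nth_mono[of "map direction_angle es" i j] that
    by (simp add: a_def n_def) (simp add: es_def)
  have less: "a i < a j" if "i < j" "j < n" for i j
    using le[of i j] inj[of i j] that by force
  have "adjacent_in E (es ! i) (es ! (Suc i mod n))" if i: "i < n" for i
  proof (cases "Suc i < n")
    case True
    have between: "\<not> (0 < cross2 (es ! i) f \<and> 0 < cross2 f (es ! Suc i))"
      if f: "f \<in> E" for f
    proof
      assume pos: "0 < cross2 (es ! i) f \<and> 0 < cross2 f (es ! Suc i)"
      obtain k where k: "k < n" "f = es ! k" using ex_index[OF f] by blast
      have "k \<le> i \<or> Suc i \<le> k" by linarith
      then have "a k \<le> a i \<or> a (Suc i) \<le> a k" using le k True i by blast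
      moreover have "a i < a (Suc i)" using less True by simp
      ultimately show False
        using pos cross_iff[OF i k(1)] cross_iff[OF k(1) True] k(2) ab[of i] ab[of k] ab[of "Suc i"]
        by auto
    qed
    have "0 < cross2 (es ! i) (es ! Suc i)"
    proof (rule ccontr)
      assume neg: "\<not> 0 < cross2 (es ! i) (es ! Suc i)"
      have "a i < a (Suc i)" using less True by simp
      then have far: "pi \<le> a (Suc i) - a i" using neg cross_iff[OF i True] by linarith
      \<comment> \<open>The quarter turn of an edge is again an edge by symmetry; it would fall
        strictly inside a gap of length at least \<open>pi\<close>.\<close>
      define f where "f = (- snd (es ! i), fst (es ! i))"
      have "f \<in> E" using flip_diag_E[of "fst (es ! i)" "snd (es ! i)"] flip_x_E in_E[OF i] by (simp add: f_def)
      then obtain k where k: "k < n" "f = es ! k" using ex_index by blast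
      have "es ! i \<noteq> (0, 0)" using in_E[OF i] zero_notin by metis
      then have "0 < cross2 (es ! i) f"
        using sum_power2_gt_zero_iff[of "fst (es ! i)" "snd (es ! i)"]
        by (simp add: f_def cross2_def power2_eq_square prod_eq_iff)
      then have "(0 < a k - a i \<and> a k - a i < pi) \<or> a k - a i < - pi" using cross_iff[OF i k(1)] k by simp
      moreover have "k \<le> i \<or> Suc i \<le> k" by linarith
      then have "a k \<le> a i \<or> a (Suc i) \<le> a k" using le k True i by blast
      ultimately show False using far ab[of i] ab[of k] ab[of "Suc i"] by linarith
    qed
    then show ?thesis using between True by (auto simp: adjacent_in_def)
  next
    case False
    then have last: "i = n - 1" "Suc i = n" using i by auto
    \<comment> \<open>The angle 0 of \<open>(1, 0)\<close> comes first, and \<open>(0, - 1)\<close>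
      forces the last angle above \<open>pi\<close>, so the closing turn is positive and less than a
      half turn.\<close>
    obtain k0 where k0: "k0 < n" "es ! k0 = (1, 0)" using ex_index[OF units(1)] by blast
    have "a k0 = 0" using k0 by (simp add: a_def direction_angle_def flip: one_complex.code)
      (simp add: Arg2pi_eq_0 complex_is_Real_iff)
    then have a0: "a 0 = 0" using le[of 0 k0] k0 ab[of 0] by simp
    obtain k1 where k1: "k1 < n" "es ! k1 = (0, - 1)" using ex_index[OF units(4)] by blast
    have "\<not> Arg2pi (Complex 0 (- 1)) \<le> pi" by (simp add: Arg2pi_le_pi)
    then have "pi < a k1" using k1 by (simp add: a_def direction_angle_def)
    then have ai: "pi < a i" using le[of k1 i] k1 i last by linarith
    have n0: "0 < n" using n3 by simp
    have "0 < cross2 (es ! i) (es ! 0)" using cross_iff[OF i n0] a0 ai by simp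
    moreover have "\<not> (0 < cross2 (es ! i) f \<and> 0 < cross2 f (es ! 0))" if f: "f \<in> E" for f
    proof
      assume pos: "0 < cross2 (es ! i) f \<and> 0 < cross2 f (es ! 0)"
      obtain k where k: "k < n" "f = es ! k" using ex_index[OF f] by blast
      have "a k \<le> a i" using le k last i by simp
      then show False
        using pos cross_iff[OF i k(1)] cross_iff[OF k(1) n0] k(2) a0 ab[of k] ab[of i] by auto
    qed
    ultimately show ?thesis using last by (auto simp: adjacent_in_def)
  qed
  then show ?thesis using that es n3 by (simp add: n_def)
qed

text \<open>The vertices are the starts of the zonogon edges in angular order:
  \<open>edge_mid_step\<close> identifies the edge vectors and \<open>start_vertex_support\<close>
  gives convexity.\<close>

lemma exists_has_edges: "\<exists>vs. has_edges E vs"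
proof -
  obtain es where es: "distinct es" "set es = E" and n3: "3 \<le> length es"
    and adj: "\<And>i. i < length es \<Longrightarrow> adjacent_in E (es ! i) (es ! (Suc i mod length es))"
    using exists_cyclic_enumeration by metis
  define n where "n = length es"
  define w where "w e = edge_mid E e - (1/2) *\<^sub>R e" for e
  define vs where "vs = map w es"
  have n: "length vs = n" "3 \<le> n" using n3 by (auto simp: vs_def n_def)
  have in_E: "es ! i \<in> E" if "i < n" for i using that es by (auto simp: n_def)
  have vertex: "vertex vs i = w (es ! (i mod n))" for i
  proof -
    have "i mod n < n" using n by simp
    then show ?thesis by (simp add: vertex_def n(1)) (simp add: vs_def n_def)
  qed
  have edge: "edge_vector vs i = es ! i" if "i < n" for i
  proof -
    have S: "Suc i mod n < n" using n by simp
    have "edge_mid E (es ! i) + (1/2) *\<^sub>R es ! i = w (es ! (Suc i mod n))"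
      using edge_mid_step[OF in_E[OF that] in_E[OF S]] adj[of i] that by (simp add: w_def n_def)
    then show ?thesis using that by (simp add: edge_vector_def vertex w_def prod_eq_iff)
  qed
  have "0 < cross2 (edge_vector vs i) (vertex vs j - vertex vs i)"
    if ij: "i < n" "j < n" "j \<noteq> i" "j \<noteq> Suc i mod n" for i j
  proof -
    \<comment> \<open>The cyclic predecessor of \<open>j\<close>; adding \<open>n\<close> first
      avoids truncated subtraction at \<open>j = 0\<close>.\<close>
    define k where "k = (j + n - 1) mod n"
    have k: "k < n" "Suc k mod n = j"
      using ij n by (auto simp: k_def mod_Suc_eq)
    then have "k \<noteq> i" using ij by auto
    have dist: "es ! a \<noteq> es ! b" if "a < n" "b < n" "a \<noteq> b" for a b
      using that es by (simp add: nth_eq_iff_index_eq n_def)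
    have "adjacent_in E (es ! k) (es ! j)" using adj[of k] k by (simp add: n_def)
    then show ?thesis
      using start_vertex_support[of "es ! i" "es ! j" "es ! k"] in_E ij k dist \<open>k \<noteq> i\<close>
      by (simp add: edge vertex w_def)
  qed
  then have "convex_ccw_polygon vs" using n by (simp add: convex_ccw_polygon_def)
  moreover have "bij_betw ((!) es) {..<n} E" using es by (simp add: bij_betw_nth n_def)
  then have "bij_betw (edge_vector vs) {..<n} E"
    using bij_betw_cong[of "{..<n}" "edge_vector vs" "(!) es" E] edge by auto
  ultimately show ?thesis using n by (auto simp: has_edges_def)
qed

section \<open>Symmetry and uniqueness of the scaled polygon\<close>

lemma dihedral_symmetric_scaled_zonogon: "dihedral_symmetric ((*\<^sub>R) r ` zonogon E)"
proof -
  have "g ` (*\<^sub>R) r ` zonogon E = (*\<^sub>R) r ` zonogon E" if "g \<in> dihedral8" for g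
    using that
  proof (induction g)
    case (flip_x g)
    have "(\<lambda>v. (- fst (g v), snd (g v))) ` (*\<^sub>R) r ` zonogon E
        = (\<lambda>v. (- fst v, snd v)) ` g ` (*\<^sub>R) r ` zonogon E"
      by (simp add: image_image)
    also have "\<dots> = (*\<^sub>R) r ` (\<lambda>v. (- fst v, snd v)) ` zonogon E"
      by (simp only: flip_x.IH) (simp add: image_image)
    finally show ?case by (simp only: flip_x_zonogon)
  next
    case (flip_y g)
    have "(\<lambda>v. (fst (g v), - snd (g v))) ` (*\<^sub>R) r ` zonogon E
        = (\<lambda>v. (fst v, - snd v)) ` g ` (*\<^sub>R) r ` zonogon E"
      by (simp add: image_image)
    also have "\<dots> = (*\<^sub>R) r ` (\<lambda>v. (fst v, - snd v)) ` zonogon E"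
      by (simp only: flip_y.IH) (simp add: image_image)
    finally show ?case by (simp only: flip_y_zonogon)
  next
    case (flip_diag g)
    have "(\<lambda>v. (snd (g v), fst (g v))) ` (*\<^sub>R) r ` zonogon E
        = (\<lambda>v. (snd v, fst v)) ` g ` (*\<^sub>R) r ` zonogon E"
      by (simp add: image_image)
    also have "\<dots> = (*\<^sub>R) r ` (\<lambda>v. (snd v, fst v)) ` zonogon E"
      by (simp only: flip_diag.IH) (simp add: image_image)
    finally show ?case by (simp only: flip_diag_zonogon)
  qed simp
  then show ?thesis by (simp add: dihedral_symmetric_def)
qed

lemma bounded_zonogon: "bounded (zonogon E)"
  using finite_E by (auto simp: zonogon_def zonogon_edge_def intro!: bounded_UN bounded_closed_segment)

end

text \<open>Iterating the translation would leave every ball. This excludes two centers of symmetry,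
  since two point reflections compose to a translation by twice the difference of their
  centers.\<close>

lemma bounded_translation_zero:
  fixes S :: "'a::real_normed_vector set"
  assumes "bounded S" "S \<noteq> {}" and shift: "\<And>x. x \<in> S \<Longrightarrow> x + v \<in> S"
  shows "v = 0"
proof (rule ccontr)
  assume "v \<noteq> 0"
  obtain x where x: "x \<in> S" using assms by blast
  have mem: "x + real n *\<^sub>R v \<in> S" for n
  proof (induction n)
    case (Suc n)
    then show ?case using shift[OF Suc] by (simp add: algebra_simps)
  qed (simp add: x)
  obtain B where B: "\<And>y. y \<in> S \<Longrightarrow> norm y \<le> B" using assms(1) by (auto simp: bounded_iff)
  obtain n where n: "B + norm x < real n * norm v"
    using reals_Archimedean3[of "norm v"] \<open>v \<noteq> 0\<close> by auto
  have "norm (real n *\<^sub>R v) \<le> norm (x + real n *\<^sub>R v) + norm x"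
    using norm_triangle_ineq4[of "x + real n *\<^sub>R v" x] by simp
  then show False using n B[OF mem[of n]] by simp
qed

lemma dihedral_symmetric_uminus:
  assumes "dihedral_symmetric P" "x \<in> P"
  shows "- x \<in> P"
proof -
  have "(\<lambda>v. (- fst v, - snd v)) \<in> dihedral8"
    using flip_x[OF flip_y[OF ident]] by simp
  then have "(\<lambda>v. (- fst v, - snd v)) ` P = P" using assms by (auto simp: dihedral_symmetric_def)
  then have "(- fst x, - snd x) \<in> P" using assms by blast
  then show ?thesis by (cases x) simp
qed

context edge_star
begin

text \<open>For any admissible pair \<open>c'\<close>, \<open>r'\<close> the curve is symmetric
  about \<open>c'\<close>, and also about the center \<open>c\<close> of the translated zonogon.
  Composing the two point reflections shifts the zonogon by \<open>2 *\<^sub>R (c - c')\<close>, so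
  boundedness gives \<open>c' = c\<close>; the midpoint condition then determines
  \<open>r'\<close>.\<close>

lemma the_scaled_polygon:
  assumes vs: "has_edges E vs"
  shows "(THE P. \<exists>c r. 0 < r \<and> P = (\<lambda>x. r *\<^sub>R (x - c)) ` polygon_curve vs \<and>
       dihedral_symmetric P \<and>
       (\<exists>i<length vs. edge_vector vs i = (1, 0) \<and>
          r *\<^sub>R (midpoint (vertex vs i) (vertex vs (Suc i)) - c) = (0, - 1)))
    = (*\<^sub>R) (1 / - snd (edge_mid E (1, 0))) ` zonogon E"
proof -
  obtain c where curve: "polygon_curve vs = (+) c ` zonogon E"
    and mid: "\<And>i. i < length vs \<Longrightarrow>
           midpoint (vertex vs i) (vertex vs (Suc i)) = c + edge_mid E (edge_vector vs i)"
    using has_edges_zonogon[OF vs] by metis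
  define r where "r = 1 / - snd (edge_mid E (1, 0))"
  have r: "0 < r" using edge_mid_unit(3) by (simp add: r_def)
  have unit: "r' *\<^sub>R edge_mid E (1, 0) = (0, - 1) \<longleftrightarrow> r' = r" for r'
    using edge_mid_unit(1,3) by (auto simp: prod_eq_iff r_def field_simps)
  have scaled: "(\<lambda>x. r *\<^sub>R (x - c)) ` polygon_curve vs = (*\<^sub>R) r ` zonogon E"
    by (simp add: curve image_image)
  obtain i where i: "i < length vs" "edge_vector vs i = (1, 0)"
    using vs unit_E by (force simp: has_edges_def bij_betw_def)
  show ?thesis unfolding r_def[symmetric]
  proof (rule the_equality)
    show "\<exists>c' r'. 0 < r' \<and> (*\<^sub>R) r ` zonogon E = (\<lambda>x. r' *\<^sub>R (x - c')) ` polygon_curve vs \<and>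
       dihedral_symmetric ((*\<^sub>R) r ` zonogon E) \<and>
       (\<exists>i<length vs. edge_vector vs i = (1, 0) \<and>
          r' *\<^sub>R (midpoint (vertex vs i) (vertex vs (Suc i)) - c') = (0, - 1))"
      using r scaled dihedral_symmetric_scaled_zonogon i mid[OF i(1)] unit
      by (intro exI[of _ c] exI[of _ r] conjI exI[of _ i]) auto
  next
    fix P
    assume "\<exists>c' r'. 0 < r' \<and> P = (\<lambda>x. r' *\<^sub>R (x - c')) ` polygon_curve vs \<and>
       dihedral_symmetric P \<and>
       (\<exists>i<length vs. edge_vector vs i = (1, 0) \<and>
          r' *\<^sub>R (midpoint (vertex vs i) (vertex vs (Suc i)) - c') = (0, - 1))"
    then obtain c' r' j where r': "0 < r'" and P: "P = (\<lambda>x. r' *\<^sub>R (x - c')) ` polygon_curve vs"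
      and sym: "dihedral_symmetric P" and j: "j < length vs" "edge_vector vs j = (1, 0)"
      and mid': "r' *\<^sub>R (midpoint (vertex vs j) (vertex vs (Suc j)) - c') = (0, - 1)" by blast
    have P': "P = (\<lambda>z. r' *\<^sub>R (z + (c - c'))) ` zonogon E"
      by (simp add: P curve image_image algebra_simps)
    have neg: "- z \<in> zonogon E" if "z \<in> zonogon E" for z
      using dihedral_symmetric_uminus[OF dihedral_symmetric_scaled_zonogon[of 1], of z] that by simp
    have "z + 2 *\<^sub>R (c - c') \<in> zonogon E" if z: "z \<in> zonogon E" for z
    proof -
      have "r' *\<^sub>R (z + (c - c')) \<in> P" using z by (auto simp: P')
      then have "- (r' *\<^sub>R (z + (c - c'))) \<in> P" using dihedral_symmetric_uminus sym by blast
      then obtain z' where z': "z' \<in> zonogon E" "r' *\<^sub>R (- (z + (c - c'))) = r' *\<^sub>R (z' + (c - c'))"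
        unfolding P' scaleR_minus_right by blast
      then have "- (z + (c - c')) = z' + (c - c')" using r' by (simp only: scaleR_cancel_left) simp
      then have "z + 2 *\<^sub>R (c - c') = - z'" by (simp add: scaleR_2 algebra_simps prod_eq_iff)
      then show ?thesis using neg[OF z'(1)] by simp
    qed
    moreover have "zonogon E \<noteq> {}"
      using unit_E by (auto simp: zonogon_def zonogon_edge_def)
    ultimately have "2 *\<^sub>R (c - c') = 0" using bounded_translation_zero[OF bounded_zonogon] by blast
    then have "c' = c" by simp
    then have "r' *\<^sub>R edge_mid E (1, 0) = (0, - 1)" using mid' mid[OF j(1)] j(2) by simp
    then have "r' = r" using unit by simp
    then show "P = (*\<^sub>R) r ` zonogon E" using P scaled \<open>c' = c\<close> by simp
  qed
qed

section \<open>Edge midpoints as sums over cones\<close>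

text \<open>Turning the half-plane from the right of \<open>(1, 0)\<close> to the right of
  \<open>e\<close> gains the cone of edges between the two directions and loses its negative, so the
  half sums combine to one full sum over the cone. The cone contains \<open>e\<close> but not
  \<open>(1, 0)\<close>, whereas the gained set contains \<open>(1, 0)\<close> but not
  \<open>e\<close>; this explains the two half edges.\<close>

lemma edge_mid_diff_unit:
  assumes e: "e \<in> E" "0 < snd e"
  shows "edge_mid E e - edge_mid E (1, 0)
    = (\<Sum>f | f \<in> E \<and> 0 < snd f \<and> snd f * fst e \<le> fst f * snd e. f) + (1/2) *\<^sub>R (1, 0) - (1/2) *\<^sub>R e"
proof -
  define S where "S e = {f \<in> E. 0 < cross2 f e}" for e
  define D where "D = {f \<in> E. 0 < snd f \<and> snd f * fst e \<le> fst f * snd e}"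
  have fin: "finite (S e)" "finite D" for e using finite_E by (auto simp: S_def D_def)
  have "S e - S (1, 0) = insert (1, 0) (D - {e})"
  proof (intro equalityI subsetI)
    fix f assume f: "f \<in> S e - S (1, 0)"
    show "f \<in> insert (1, 0) (D - {e})"
    proof (cases "snd f = 0")
      case True
      then have "0 < fst f" using f e by (auto simp: S_def cross2_def zero_less_mult_iff)
      moreover have "f = (1, 0) \<or> f = - (1, 0)"
        using parallel[OF unit_E, of f] f True by (simp add: S_def cross2_def)
      ultimately show ?thesis by auto
    qed (use f in \<open>auto simp: S_def D_def cross2_def\<close>)
  next
    fix f assume f: "f \<in> insert (1, 0) (D - {e})"
    show "f \<in> S e - S (1, 0)"
    proof (cases "f = (1, 0)")
      case False
      then have f: "f \<in> D" "f \<noteq> e" using f by auto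
      have "cross2 e f \<noteq> 0" using parallel[OF e(1), of f] f e by (auto simp: D_def)
      then have "fst f * snd e \<noteq> snd f * fst e" by (simp add: cross2_def mult.commute)
      then show ?thesis using f by (auto simp: S_def D_def cross2_def)
    qed (use e unit_E in \<open>auto simp: S_def cross2_def\<close>)
  qed
  moreover have "(1, 0) \<notin> D" by (simp add: D_def)
  moreover have "e \<in> D" using e by (simp add: D_def mult.commute)
  ultimately have 1: "\<Sum>(S e - S (1, 0)) = (1, 0) + (\<Sum>D - e)"
    using fin by (simp add: sum_diff1)
  have "S (1, 0) - S e = uminus ` D"
  proof (intro equalityI subsetI)
    fix f assume "f \<in> S (1, 0) - S e"
    then have "- f \<in> D" using uminus_E[of f] by (auto simp: S_def D_def cross2_def)
    then show "f \<in> uminus ` D" by (metis imageI minus_minus)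
  qed (use uminus_E in \<open>force simp: S_def D_def cross2_def\<close>)
  then have "\<Sum>(S (1, 0) - S e) = (\<Sum>f\<in>D. - f)"
    by (simp add: sum.reindex)
  then have 2: "\<Sum>(S (1, 0) - S e) = - \<Sum>D" by (simp add: sum_negf)
  have "\<Sum>(S e) = \<Sum>(S e \<inter> S (1, 0)) + \<Sum>(S e - S (1, 0))"
    "\<Sum>(S (1, 0)) = \<Sum>(S e \<inter> S (1, 0)) + \<Sum>(S (1, 0) - S e)"
    using sum.Int_Diff[OF fin(1)] by (metis Int_commute)+
  then have "\<Sum>(S e) - \<Sum>(S (1, 0)) = (1, 0) + 2 *\<^sub>R \<Sum>D - e"
    using 1 2 by (simp add: scaleR_2 algebra_simps)
  then have "edge_mid E e - edge_mid E (1, 0) = (1/2) *\<^sub>R ((1, 0) + 2 *\<^sub>R \<Sum>D - e)"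
    unfolding edge_mid_def S_def by (simp flip: scaleR_diff_right)
  then show ?thesis unfolding D_def[symmetric] by (simp add: prod_eq_iff field_simps)
qed

text \<open>The two upper quadrants contribute equally, and the reflection in the diagonal exchanges
  the coordinates. The divisor thereby becomes a first moment of the cone with \<open>k = 0\<close>,
  covered by the same estimate as the numerators; \<open>1/2\<close> is the share of the edge
  \<open>(0, 1)\<close> on the axis.\<close>

lemma edge_mid_unit_quadrant:
  "- snd (edge_mid E (1, 0)) = (\<Sum>f | f \<in> E \<and> 0 < fst f \<and> 0 < snd f. fst f) + 1/2"
proof -
  define A where "A = {f \<in> E. 0 < fst f \<and> 0 < snd f}"
  define A' where "A' = {f \<in> E. fst f < 0 \<and> 0 < snd f}"
  have fin: "finite A" "finite A'" using finite_E by (auto simp: A_def A'_def)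
  have "(0, 1) \<in> E" using flip_diag_E[OF unit_E] .
  have axis: "f = (0, 1)" if "f \<in> E" "fst f = 0" "0 < snd f" for f
    using parallel[OF \<open>(0, 1) \<in> E\<close> that(1)] that by (auto simp: cross2_def)
  have "{f \<in> E. 0 < snd f} = insert (0, 1) (A \<union> A')"
  proof (intro equalityI subsetI)
    fix f assume f: "f \<in> {f \<in> E. 0 < snd f}"
    show "f \<in> insert (0, 1) (A \<union> A')"
    proof (cases "fst f = 0")
      case True
      then show ?thesis using axis[of f] f by simp
    next
      case False
      then show ?thesis using f by (simp add: A_def A'_def linorder_neq_iff disj_commute)
    qed
  next
    fix f assume "f \<in> insert (0, 1) (A \<union> A')"
    then show "f \<in> {f \<in> E. 0 < snd f}" using \<open>(0, 1) \<in> E\<close> by (auto simp: A_def A'_def)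
  qed
  moreover have "(0, 1) \<notin> A \<union> A'" "A \<inter> A' = {}" by (auto simp: A_def A'_def)
  ultimately have "(\<Sum>f | f \<in> E \<and> 0 < snd f. snd f) = 1 + ((\<Sum>f\<in>A. snd f) + (\<Sum>f\<in>A'. snd f))"
    using fin by (simp add: sum.union_disjoint)
  also have "(\<Sum>f\<in>A'. snd f) = (\<Sum>f\<in>A. snd f)"
    using flip_x_E
    by (intro sum.reindex_bij_witness[of _ "\<lambda>f. (- fst f, snd f)" "\<lambda>f. (- fst f, snd f)"])
      (auto simp: A_def A'_def)
  also have "(\<Sum>f\<in>A. snd f) = (\<Sum>f\<in>A. fst f)"
    using flip_diag_E
    by (intro sum.reindex_bij_witness[of _ "\<lambda>f. (snd f, fst f)" "\<lambda>f. (snd f, fst f)"])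
      (auto simp: A_def)
  finally show ?thesis unfolding edge_mid_unit(2) A_def by simp
qed

text \<open>The closure maps are not the reflections themselves but their actions on edge
  directions, with the minus sign of \<open>reflection_zonogon_edge\<close>; this is the form in
  which properties of \<open>zonogon_edge E e\<close> can be transported.\<close>

lemma octant_induct:
  assumes octant: "\<And>e. e \<in> E \<Longrightarrow> 0 \<le> snd e \<Longrightarrow> snd e \<le> fst e \<Longrightarrow> P e"
    and flip_x: "\<And>e. P e \<Longrightarrow> P (fst e, - snd e)"
    and flip_y: "\<And>e. P e \<Longrightarrow> P (- fst e, snd e)"
    and flip_diag: "\<And>e. P e \<Longrightarrow> P (- snd e, - fst e)"
    and e: "e \<in> E"
  shows "P e"
proof -
  obtain x y where xy: "e = (x, y)" by (cases e)
  have abs: "(\<bar>x\<bar>, \<bar>y\<bar>) \<in> E"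
    using e xy flip_x_E[of x y] flip_y_E[of x y] flip_y_E[of "- x" y] by (auto simp: abs_if)
  have "P (\<bar>x\<bar>, \<bar>y\<bar>)"
  proof (cases "\<bar>y\<bar> \<le> \<bar>x\<bar>")
    case False
    then have "P (\<bar>y\<bar>, \<bar>x\<bar>)" using octant flip_diag_E[OF abs] by simp
    then show ?thesis using flip_diag[of "(\<bar>y\<bar>, \<bar>x\<bar>)"] flip_x[of "(- \<bar>x\<bar>, - \<bar>y\<bar>)"] flip_y[of "(- \<bar>x\<bar>, \<bar>y\<bar>)"]
      by simp
  qed (use octant abs in simp)
  then show ?thesis
    using xy flip_x[of "(\<bar>x\<bar>, \<bar>y\<bar>)"] flip_y[of "(\<bar>x\<bar>, \<bar>y\<bar>)"] flip_y[of "(\<bar>x\<bar>, - \<bar>y\<bar>)"]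
    by (auto simp: abs_if split: if_splits)
qed

end

section \<open>Reflections and the distance to the limit curve\<close>

lemma infdist_image_le:
  assumes "A \<noteq> {}" "\<phi> ` A \<subseteq> A" and "\<And>u v. dist (\<phi> u) (\<phi> v) = dist u v"
  shows "infdist (\<phi> x) A \<le> infdist x A"
  unfolding infdist_notempty[OF assms(1), of x]
proof (rule cINF_greatest[OF assms(1)])
  fix a assume "a \<in> A"
  then have "infdist (\<phi> x) A \<le> dist (\<phi> x) (\<phi> a)" using assms(2) by (intro infdist_le) auto
  then show "infdist (\<phi> x) A \<le> dist x a" using assms(3) by simp
qed

lemma infdist_limit_curve:
  "infdist (- fst x, snd x) (limit_curve p) \<le> infdist x (limit_curve p)"
  "infdist (fst x, - snd x) (limit_curve p) \<le> infdist x (limit_curve p)"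
  "infdist (snd x, fst x) (limit_curve p) \<le> infdist x (limit_curve p)"
proof -
  have ne: "limit_curve p \<noteq> {}" using ident by (auto simp: limit_curve_def limit_arc_def)
  have dists: "dist (- fst u, snd u) (- fst v, snd v) = dist u v" "dist (fst u, - snd u) (fst v, - snd v) = dist u v"
    "dist (snd u, fst u) (snd v, fst v) = dist u v" for u v :: "real \<times> real"
    by (simp_all add: dist_prod_def dist_minus add.commute)
  have sub: "\<phi> ` limit_curve p \<subseteq> limit_curve p"
    if \<phi>: "\<And>g. g \<in> dihedral8 \<Longrightarrow> (\<lambda>v. \<phi> (g v)) \<in> dihedral8" for \<phi>
  proof
    fix y assume "y \<in> \<phi> ` limit_curve p"
    then obtain g w where g: "g \<in> dihedral8" "w \<in> limit_arc p" "y = \<phi> (g w)"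
      unfolding limit_curve_def by blast
    then have "y \<in> (\<lambda>v. \<phi> (g v)) ` limit_arc p" by blast
    then show "y \<in> limit_curve p" unfolding limit_curve_def using \<phi>[OF g(1)] by blast
  qed
  have curves: "(\<lambda>v. (- fst v, snd v)) ` limit_curve p \<subseteq> limit_curve p"
    "(\<lambda>v. (fst v, - snd v)) ` limit_curve p \<subseteq> limit_curve p"
    "(\<lambda>v. (snd v, fst v)) ` limit_curve p \<subseteq> limit_curve p"
    by (rule sub, erule dihedral8.intros)+
  show
    "infdist (- fst x, snd x) (limit_curve p) \<le> infdist x (limit_curve p)"
    "infdist (fst x, - snd x) (limit_curve p) \<le> infdist x (limit_curve p)"
    "infdist (snd x, fst x) (limit_curve p) \<le> infdist x (limit_curve p)"
    using infdist_image_le[OF ne curves(1) dists(1)] infdist_image_le[OF ne curves(2) dists(2)]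
      infdist_image_le[OF ne curves(3) dists(3)] by simp_all
qed

section \<open>Moments of lattice points in a cone\<close>

text \<open>Increments of \<open>V\<close> dominate the oscillation of \<open>h\<close>, so each
  cell of length \<open>1 / X\<close> costs at most the increment of \<open>V\<close> and the total
  telescopes to a bound independent of \<open>X\<close>. Leaving \<open>V\<close> free covers both a
  decreasing \<open>h\<close> and a product that is not monotone.\<close>

lemma riemann_sum_error:
  fixes h V :: "real \<Rightarrow> real"
  assumes X: "0 < X" and Y: "0 \<le> Y" and int: "h integrable_on {0..Y}"
    and V: "\<And>s t. 0 \<le> s \<Longrightarrow> s \<le> t \<Longrightarrow> t \<le> Y \<Longrightarrow> \<bar>h s - h t\<bar> \<le> V t - V s"
    and M: "\<And>t. 0 \<le> t \<Longrightarrow> t \<le> Y \<Longrightarrow> \<bar>h t\<bar> \<le> M"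
  shows "\<bar>(\<Sum>b = 1..nat \<lfloor>X * Y\<rfloor>. h (real b / X)) - X * integral {0..Y} h\<bar> \<le> V Y - V 0 + M"
proof -
  define m where "m = nat \<lfloor>X * Y\<rfloor>"
  have XY: "0 \<le> X * Y" using X Y by simp
  have m: "real m \<le> X * Y" "X * Y < real m + 1" using XY by (simp_all add: m_def)
  have le_Y: "real k / X \<le> Y" if "k \<le> m" for k
  proof -
    have "real k \<le> X * Y" using m(1) that by linarith
    then show ?thesis using X by (simp add: field_simps)
  qed
  have int': "h integrable_on {s..t}" if "0 \<le> s" "t \<le> Y" for s t
    using int by (rule integrable_subinterval_real) (use that in auto)
  have partial: "\<bar>(\<Sum>b = 1..k. h (real b / X)) - X * integral {0..real k / X} h\<bar> \<le> V (real k / X) - V 0"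
    if "k \<le> m" for k
    using that
  proof (induction k)
    case (Suc k)
    define s t where "s = real k / X" and "t = real (Suc k) / X"
    have st: "0 \<le> s" "s \<le> t" "t \<le> Y" "X * (t - s) = 1"
      using X Suc.prems le_Y[of "Suc k"] by (auto simp: s_def t_def field_simps)
    have D: "0 \<le> V t - V s" using V[of s t] st by linarith
    have "((\<lambda>x. h t - h x) has_integral ((t - s) * h t - integral {s..t} h)) {s..t}"
      using has_integral_diff[OF has_integral_const_real[of "h t" s t] integrable_integral[OF int'[of s t]]] st
      by simp
    moreover have "norm (h t - h x) \<le> V t - V s" if "x \<in> {s..t}" for x
      using V[of x t] V[of s x] that st by auto
    ultimately have "norm ((t - s) * h t - integral {s..t} h) \<le> (V t - V s) * measure lborel {s..t}"
      using has_integral_bound_real[OF D] by blast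
    then have "X * \<bar>(t - s) * h t - integral {s..t} h\<bar> \<le> X * ((V t - V s) * (t - s))"
      using st X by simp
    also have "\<dots> = (V t - V s) * (X * (t - s))" by simp
    also have "\<dots> = V t - V s" using st(4) by simp
    finally have "\<bar>X * ((t - s) * h t - integral {s..t} h)\<bar> \<le> V t - V s" using X by (simp add: abs_mult)
    moreover have "X * ((t - s) * h t - integral {s..t} h) = h t - X * integral {s..t} h"
      using st(4) by (metis (no_types) mult.assoc mult_1 right_diff_distrib)
    moreover have "integral {0..t} h = integral {0..s} h + integral {s..t} h"
      using st int'[of 0 t] by (intro Henstock_Kurzweil_Integration.integral_combine[symmetric]) auto
    then have "X * integral {0..t} h = X * integral {0..s} h + X * integral {s..t} h"
      by (simp add: distrib_left)
    moreover have "(\<Sum>b = 1..Suc k. h (real b / X)) = (\<Sum>b = 1..k. h (real b / X)) + h t"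
      by (simp add: t_def)
    ultimately show ?case
      using Suc.IH Suc.prems unfolding t_def[symmetric] s_def[symmetric] by linarith
  qed simp
  \<comment> \<open>What remains is the piece from the last sample point to \<open>Y\<close>, of
    length at most \<open>1 / X\<close>; it is paid for by \<open>M\<close>.\<close>
  define s where "s = real m / X"
  have s: "0 \<le> s" "s \<le> Y" "X * (Y - s) \<le> 1"
    using X le_Y[of m] m by (simp_all add: s_def right_diff_distrib)
  have M0: "0 \<le> M" using M[of 0] Y by force
  have "norm (integral {s..Y} h) \<le> M * measure lborel {s..Y}"
    using has_integral_bound_real[OF M0 finite.emptyI integrable_integral[OF int'[of s Y]]] M s by auto
  then have "X * \<bar>integral {s..Y} h\<bar> \<le> X * (M * (Y - s))" using s X by simp
  also have "\<dots> = M * (X * (Y - s))" by simp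
  also have "\<dots> \<le> M * 1" using s M0 by (intro mult_left_mono)
  finally have "\<bar>X * integral {s..Y} h\<bar> \<le> M" using X by (simp add: abs_mult)
  moreover have "integral {0..Y} h = integral {0..s} h + integral {s..Y} h"
    using s int by (intro Henstock_Kurzweil_Integration.integral_combine[symmetric]) auto
  moreover have "V s \<le> V Y" using V[of s Y] s by linarith
  ultimately show ?thesis
    using partial[of m] by (simp add: s_def[symmetric] m_def[symmetric] algebra_simps)
qed

text \<open>The products \<open>U (U + 1)\<close> and \<open>K (K + 1)\<close> differ from
  \<open>u\<^sup>2\<close> and \<open>l\<^sup>2\<close> by at most \<open>u\<close> and
  \<open>l\<close>; half the difference is therefore off by at most \<open>(u + l) / 2\<close>,
  hence by at most \<open>u\<close>.\<close>

lemma lattice_interval_sums: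
  fixes l u :: real
  assumes "0 \<le> l" "l \<le> u"
  defines "S \<equiv> {a::nat. 0 < a \<and> l \<le> real a \<and> real a \<le> u}"
  shows "finite S" "\<bar>real (card S) - (u - l)\<bar> \<le> 1" "\<bar>(\<Sum>a\<in>S. real a) - (u\<^sup>2 - l\<^sup>2) / 2\<bar> \<le> u"
proof -
  \<comment> \<open>\<open>K\<close> is the last natural number before the interval. For
    \<open>l = 0\<close> the truncated subtraction gives \<open>K = 0\<close>, which is right
    because only positive integers are counted.\<close>
  define U K where "U = nat \<lfloor>u\<rfloor>" and "K = nat \<lceil>l\<rceil> - 1"
  have U: "real U \<le> u" "u < real U + 1" using assms by (simp_all add: U_def)
  have K: "real K \<le> l" "l \<le> real K + 1" "real K < l \<or> K = 0"
    using assms by (simp_all add: K_def) linarith+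
  have S: "S = {K<..U}"
  proof (intro equalityI subsetI)
    fix a assume "a \<in> S"
    then have a: "0 < a" "l \<le> real a" "real a \<le> u" by (auto simp: S_def)
    then show "a \<in> {K<..U}" using K U by auto
  next
    fix a assume a: "a \<in> {K<..U}"
    then have "real K + 1 \<le> real a" "real a \<le> real U" by auto
    then show "a \<in> S" using K U a unfolding S_def by auto
  qed
  then show "finite S" by simp
  have KU: "K \<le> U" using K U assms by linarith
  then have "real (card S) = real U - real K" by (simp add: S)
  then show "\<bar>real (card S) - (u - l)\<bar> \<le> 1" using U K by linarith
  have tri: "(\<Sum>a\<in>{..n}. real a) = real n * (real n + 1) / 2" for n :: nat
    by (induction n) (auto simp: field_simps)
  have "{..U} = {..K} \<union> {K<..U}" "{..K} \<inter> {K<..U} = {}" using KU by auto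
  then have "(\<Sum>a\<in>{..U}. real a) = (\<Sum>a\<in>{..K}. real a) + (\<Sum>a\<in>{K<..U}. real a)"
    by (metis finite_atMost finite_greaterThanAtMost sum.union_disjoint)
  then have sum: "(\<Sum>a\<in>S. real a) = real U * (real U + 1) / 2 - real K * (real K + 1) / 2"
    unfolding S tri by linarith
  have "real U * real U \<le> u * u" using U by (intro mult_mono) auto
  then have 1: "real U * (real U + 1) \<le> u\<^sup>2 + u" using U by (simp add: power2_eq_square algebra_simps)
  have 2: "u\<^sup>2 - u \<le> real U * (real U + 1)"
  proof (cases "1 \<le> u")
    case True
    then have "(u - 1) * u \<le> real U * (real U + 1)" using U by (intro mult_mono) auto
    then show ?thesis by (simp add: power2_eq_square algebra_simps)
  next
    case False
    then have "u * u \<le> u * 1" using assms by (intro mult_left_mono) auto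
    then show ?thesis by (simp add: power2_eq_square) (smt (verit) mult_nonneg_nonneg of_nat_0_le_iff)
  qed
  have "real K * real K \<le> l * l" using K by (intro mult_mono) auto
  then have 3: "real K * (real K + 1) \<le> l\<^sup>2 + l" using K by (simp add: power2_eq_square algebra_simps)
  have 4: "l\<^sup>2 - l \<le> real K * (real K + 1)"
  proof (cases "1 \<le> l")
    case True
    then have "(l - 1) * l \<le> real K * (real K + 1)" using K by (intro mult_mono) auto
    then show ?thesis by (simp add: power2_eq_square algebra_simps)
  next
    case False
    then have "l * l \<le> l * 1" using assms by (intro mult_left_mono) auto
    then show ?thesis by (simp add: power2_eq_square) (smt (verit) mult_nonneg_nonneg of_nat_0_le_iff)
  qed
  show "\<bar>(\<Sum>a\<in>S. real a) - (u\<^sup>2 - l\<^sup>2) / 2\<bar> \<le> u"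
  proof -
    have "\<bar>P / 2 - Q / 2 - (u\<^sup>2 - l\<^sup>2) / 2\<bar> \<le> u"
      if "P \<le> u\<^sup>2 + u" "u\<^sup>2 - u \<le> P" "Q \<le> l\<^sup>2 + l" "l\<^sup>2 - l \<le> Q" for P Q
      using that assms(1,2) by (simp add: abs_le_iff field_simps)
    then show ?thesis unfolding sum using 1 2 3 4 by blast
  qed
qed

section \<open>The boundary of the ball and the cones below it\<close>

definition superellipse :: "real \<Rightarrow> real \<Rightarrow> real" where
  "superellipse p y = (1 - y powr p) powr (1 / p)"

text \<open>The height at which the ray \<open>x = k * y\<close> leaves the ball: there
  \<open>(1 + k powr p) * y powr p = 1\<close>.\<close>

definition cone_height :: "real \<Rightarrow> real \<Rightarrow> real" where
  "cone_height p k = (1 + k powr p) powr (- 1 / p)"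

text \<open>Cones are indexed by the reciprocal slope \<open>k\<close> of their upper side, so that
  \<open>k = 0\<close> is the whole open quadrant, which yields the scaling divisor. The horizontal
  direction would be \<open>k\<close> infinite and is treated separately.\<close>

definition lattice_cone :: "real \<Rightarrow> real \<Rightarrow> real \<Rightarrow> (nat \<times> nat) set" where
  "lattice_cone p X k = {(a, b). 0 < a \<and> 0 < b \<and> k * real b \<le> real a \<and>
     (real a / X) powr p + (real b / X) powr p \<le> 1}"

text \<open>This and the next definition are the integrals of \<open>x\<close> and of
  \<open>y\<close> over the region \<open>k * y \<le> x \<le> superellipse p y\<close>, with the
  inner integration in \<open>x\<close> already carried out.\<close>

definition cone_moment_x :: "real \<Rightarrow> real \<Rightarrow> real" where
  "cone_moment_x p k = integral {0..cone_height p k} (\<lambda>y. ((superellipse p y)\<^sup>2 - (k * y)\<^sup>2) / 2)"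

definition cone_moment_y :: "real \<Rightarrow> real \<Rightarrow> real" where
  "cone_moment_y p k = integral {0..cone_height p k} (\<lambda>y. y * (superellipse p y - k * y))"

locale positive_exponent =
  fixes p :: real
  assumes p: "0 < p"
begin

lemma powr_le_one:
  assumes "0 \<le> y" "y \<le> 1"
  shows "y powr p \<le> 1"
  using powr_mono2[of p y 1] assms p by simp

lemma le_one_if_powr_le_one:
  assumes "y powr p \<le> 1"
  shows "y \<le> 1"
proof (rule ccontr)
  assume "\<not> y \<le> 1"
  then have "1 powr p < y powr p" using p by (intro powr_less_mono2) auto
  then show False using assms unfolding powr_one_eq_one by linarith
qed

lemma le_superellipse_iff:
  assumes "0 \<le> x" "0 \<le> y" "y \<le> 1"
  shows "x \<le> superellipse p y \<longleftrightarrow> x powr p + y powr p \<le> 1"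
proof -
  have z: "0 \<le> 1 - y powr p" using powr_le_one assms by simp
  have "x \<le> superellipse p y \<longleftrightarrow> x powr p \<le> superellipse p y powr p"
  proof
    show "x powr p \<le> superellipse p y powr p" if "x \<le> superellipse p y"
      using that assms p by (intro powr_mono2) auto
    show "x \<le> superellipse p y" if "x powr p \<le> superellipse p y powr p"
      using powr_less_mono2[of p "superellipse p y" x] that assms p
      by (fastforce simp: superellipse_def)
  qed
  also have "superellipse p y powr p = 1 - y powr p"
    using p z by (simp add: superellipse_def powr_powr)
  finally show ?thesis by linarith
qed

lemma superellipse_bounds:
  assumes "0 \<le> y" "y \<le> 1"
  shows "0 \<le> superellipse p y" "superellipse p y \<le> 1"
proof -
  have "0 \<le> y powr p" "y powr p \<le> 1" using assms by (auto intro: powr_le_one)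
  then have "(1 - y powr p) powr (1 / p) \<le> 1 powr (1 / p)" using p by (intro powr_mono2) auto
  then show "superellipse p y \<le> 1" by (simp add: superellipse_def)
qed (simp add: superellipse_def)

lemma superellipse_antimono:
  assumes "0 \<le> x" "x \<le> y" "y \<le> 1"
  shows "superellipse p y \<le> superellipse p x"
proof -
  have "x powr p \<le> y powr p" "y powr p \<le> 1" using assms p by (auto intro: powr_mono2 powr_le_one)
  then show ?thesis using p by (auto simp: superellipse_def intro: powr_mono2)
qed

lemma continuous_on_superellipse: "continuous_on {0..1} (superellipse p)"
proof -
  show ?thesis
    unfolding superellipse_def using p by (intro continuous_intros continuous_on_powr') (auto simp: powr_le_one)
qed

lemma cone_height_bounds: "0 < cone_height p k" "cone_height p k \<le> 1"
proof -
  have "1 \<le> 1 + k powr p" by simp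
  then have "1 powr (1 / p) \<le> (1 + k powr p) powr (1 / p)" using p by (intro powr_mono2) auto
  then show "0 < cone_height p k" "cone_height p k \<le> 1"
    using divide_le_eq_1[of 1 "(1 + k powr p) powr (1 / p)"]
    by (auto simp: cone_height_def powr_minus_divide)
qed

lemma cone_height_powr: "cone_height p k powr p = 1 / (1 + k powr p)"
proof -
  have "0 < 1 + k powr p" by (simp add: add_pos_nonneg)
  then have "cone_height p k powr p = (1 + k powr p) powr (- 1)"
    using p by (simp add: cone_height_def powr_powr del: powr_minus_divide)
  then show ?thesis by (simp add: powr_minus_divide)
qed

lemma superellipse_cone_height:
  assumes "0 \<le> k"
  shows "superellipse p (cone_height p k) = k * cone_height p k"
proof -
  have pos: "0 < 1 + k powr p" by (simp add: add_pos_nonneg)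
  then have "1 - cone_height p k powr p = k powr p / (1 + k powr p)"
    by (simp add: cone_height_powr field_simps)
  then have "superellipse p (cone_height p k) = (k powr p) powr (1 / p) / (1 + k powr p) powr (1 / p)"
    by (simp add: superellipse_def powr_divide)
  also have "\<dots> = k * cone_height p k"
    using p assms by (simp add: cone_height_def powr_powr powr_minus_divide)
  finally show ?thesis .
qed

lemma cone_slice_bounds:
  assumes "0 \<le> k" "0 \<le> y" "y \<le> cone_height p k"
  shows "0 \<le> k * y" "k * y \<le> superellipse p y"
proof -
  have "k * y \<le> k * cone_height p k" using assms by (intro mult_left_mono)
  also have "\<dots> \<le> superellipse p y"
    using superellipse_cone_height superellipse_antimono[of y "cone_height p k"] cone_height_bounds assms
    by simp
  finally show "k * y \<le> superellipse p y" .
qed (use assms in simp)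

text \<open>Above the critical height even the leftmost point of the cone is outside the ball. This
  is what bounds the range of slices.\<close>

lemma cone_height_less:
  assumes "0 \<le> k" "cone_height p k < y" "k * y \<le> x"
  shows "1 < x powr p + y powr p"
proof -
  have y: "0 < y" using cone_height_bounds(1)[of k] assms by linarith
  have pos: "0 < 1 + k powr p" by (simp add: add_pos_nonneg)
  have "cone_height p k powr p < y powr p"
    using assms p cone_height_bounds(1)[of k] by (intro powr_less_mono2) auto
  then have "1 < (1 + k powr p) * y powr p" using pos by (simp add: cone_height_powr field_simps)
  also have "\<dots> = y powr p + (k * y) powr p" using assms y by (simp add: powr_mult algebra_simps)
  also have "(k * y) powr p \<le> x powr p" using assms y p by (intro powr_mono2) auto
  finally show ?thesis by simp
qed

text \<open>A horizontal slice is a single interval whose left end is nondecreasing and whose right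
  end is nonincreasing in \<open>b\<close>; these monotonicities feed the variation bound of the
  Riemann sum.\<close>

lemma lattice_cone_slices:
  assumes X: "0 < X" and k: "0 \<le> k"
  shows "lattice_cone p X k = (\<lambda>(b, a). (a, b)) ` (SIGMA b:{1..nat \<lfloor>X * cone_height p k\<rfloor>}.
    {a. 0 < a \<and> k * real b \<le> real a \<and> real a \<le> X * superellipse p (real b / X)})"
proof -
  have iff: "(a, b) \<in> lattice_cone p X k \<longleftrightarrow> b \<in> {1..nat \<lfloor>X * cone_height p k\<rfloor>} \<and>
      0 < a \<and> k * real b \<le> real a \<and> real a \<le> X * superellipse p (real b / X)" for a b
  proof -
    have b_iff: "b \<in> {1..nat \<lfloor>X * cone_height p k\<rfloor>} \<longleftrightarrow> 0 < b \<and> real b / X \<le> cone_height p k"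
    proof -
      have "0 \<le> X * cone_height p k" using X cone_height_bounds(1)[of k] by simp
      then have "b \<le> nat \<lfloor>X * cone_height p k\<rfloor> \<longleftrightarrow> real b \<le> X * cone_height p k"
        using le_nat_iff[of "\<lfloor>X * cone_height p k\<rfloor>" b] le_floor_iff[of "int b" "X * cone_height p k"]
        by simp
      also have "\<dots> \<longleftrightarrow> real b / X \<le> cone_height p k" using X by (simp add: pos_divide_le_eq mult.commute)
      finally show ?thesis by auto
    qed
    have "(real a / X) powr p + (real b / X) powr p \<le> 1 \<longleftrightarrow> real a \<le> X * superellipse p (real b / X)"
      if "real b / X \<le> cone_height p k"
    proof -
      have "real b / X \<le> 1" using that cone_height_bounds(2)[of k] by linarith
      then have "real a / X \<le> superellipse p (real b / X) \<longleftrightarrow>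
          (real a / X) powr p + (real b / X) powr p \<le> 1"
        using le_superellipse_iff X by simp
      then show ?thesis using X by (simp add: pos_divide_le_eq mult.commute)
    qed
    moreover have "real b / X \<le> cone_height p k"
      if "(real a / X) powr p + (real b / X) powr p \<le> 1" "k * real b \<le> real a"
    proof (rule ccontr)
      assume "\<not> ?thesis"
      moreover have "k * (real b / X) \<le> real a / X"
        using divide_right_mono[OF that(2), of X] X by simp
      ultimately show False using cone_height_less[OF k, of "real b / X" "real a / X"] that(1) by simp
    qed
    ultimately show ?thesis unfolding b_iff lattice_cone_def by blast
  qed
  show ?thesis
  proof (intro set_eqI iffI)
    fix v assume "v \<in> lattice_cone p X k"
    then show "v \<in> (\<lambda>(b, a). (a, b)) ` (SIGMA b:{1..nat \<lfloor>X * cone_height p k\<rfloor>}.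
        {a. 0 < a \<and> k * real b \<le> real a \<and> real a \<le> X * superellipse p (real b / X)})"
      using iff[of "fst v" "snd v"] by (intro image_eqI[of _ _ "(snd v, fst v)"]) auto
  qed (use iff in auto)
qed

lemma finite_lattice_cone:
  assumes "0 < X" "0 \<le> k"
  shows "finite (lattice_cone p X k)"
proof -
  have "finite {a::nat. 0 < a \<and> k * real b \<le> real a \<and> real a \<le> X * superellipse p (real b / X)}" for b
    by (rule finite_subset[of _ "{..nat \<lfloor>X * superellipse p (real b / X)\<rfloor>}"]) (auto simp: le_nat_floor)
  then show ?thesis using assms by (auto simp: lattice_cone_slices)
qed

lemma lattice_cone_sum:
  assumes "0 < X" "0 \<le> k"
  shows "(\<Sum>(a, b)\<in>lattice_cone p X k. f a b) = (\<Sum>b = 1..nat \<lfloor>X * cone_height p k\<rfloor>.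
    \<Sum>a | 0 < a \<and> k * real b \<le> real a \<and> real a \<le> X * superellipse p (real b / X). f a b)"
proof -
  have "finite {a::nat. 0 < a \<and> k * real b \<le> real a \<and> real a \<le> X * superellipse p (real b / X)}" for b
    by (rule finite_subset[of _ "{..nat \<lfloor>X * superellipse p (real b / X)\<rfloor>}"]) (auto simp: le_nat_floor)
  then show ?thesis
    unfolding lattice_cone_slices[OF assms]
    by (subst sum.reindex) (auto simp: inj_on_def sum.Sigma split_def)
qed

lemma cone_slice_integrable:
  "(\<lambda>y. ((superellipse p y)\<^sup>2 - (k * y)\<^sup>2) / 2) integrable_on {0..cone_height p k}"
  "(\<lambda>y. y * (superellipse p y - k * y)) integrable_on {0..cone_height p k}"
proof -
  have c: "continuous_on {0..cone_height p k} (superellipse p)"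
    using continuous_on_superellipse by (rule continuous_on_subset) (use cone_height_bounds in auto)
  show "(\<lambda>y. ((superellipse p y)\<^sup>2 - (k * y)\<^sup>2) / 2) integrable_on {0..cone_height p k}"
    "(\<lambda>y. y * (superellipse p y - k * y)) integrable_on {0..cone_height p k}"
    by (intro integrable_continuous_real continuous_intros c; simp)+
qed

text \<open>There are at most \<open>X\<close> slices, each off by at most \<open>X\<close>, and the
  Riemann error of the decreasing slice function (with \<open>V = - h\<close>) is at most 1 before
  multiplication by \<open>X\<^sup>2\<close>. The constant 4 is the one shared with the other
  moment, where it arises as 3 + 1.\<close>

lemma lattice_cone_moment_x:
  assumes X: "0 < X" and k: "0 \<le> k"
  shows "\<bar>(\<Sum>(a, b)\<in>lattice_cone p X k. real a) - X ^ 3 * cone_moment_x p k\<bar> \<le> 4 * X\<^sup>2"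
proof -
  define Y where "Y = cone_height p k"
  define m where "m = nat \<lfloor>X * Y\<rfloor>"
  define h where "h y = ((superellipse p y)\<^sup>2 - (k * y)\<^sup>2) / 2" for y
  have Y: "0 < Y" "Y \<le> 1" using cone_height_bounds by (auto simp: Y_def)
  have "real m \<le> X * Y" using X Y by (simp add: m_def)
  also have "X * Y \<le> X * 1" using X Y by (intro mult_left_mono) auto
  finally have m: "real m \<le> X" by simp
  have slice: "0 \<le> k * y" "k * y \<le> superellipse p y" "superellipse p y \<le> 1" if "0 \<le> y" "y \<le> Y" for y
    using cone_slice_bounds[OF k] superellipse_bounds(2)[of y] that Y unfolding Y_def[symmetric] by auto
  have b_Y: "real b / X \<le> Y" if "b \<in> {1..m}" for b
    using that X Y by (auto simp: m_def le_nat_iff le_floor_iff field_simps)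
  have anti: "h t \<le> h s" if "0 \<le> s" "s \<le> t" "t \<le> Y" for s t
  proof -
    have "(superellipse p t)\<^sup>2 \<le> (superellipse p s)\<^sup>2"
      using superellipse_antimono[of s t] superellipse_bounds(1)[of t] that Y by (intro power_mono) auto
    moreover have "(k * s)\<^sup>2 \<le> (k * t)\<^sup>2" using that k by (intro power_mono mult_left_mono) auto
    ultimately show ?thesis by (simp add: h_def)
  qed
  have bound: "0 \<le> h y" "h y \<le> 1 / 2" if "0 \<le> y" "y \<le> Y" for y
  proof -
    have "(k * y)\<^sup>2 \<le> (superellipse p y)\<^sup>2" "(superellipse p y)\<^sup>2 \<le> 1\<^sup>2"
      using slice[OF that] by (intro power_mono; linarith)+
    moreover have "2 * h y = (superellipse p y)\<^sup>2 - (k * y)\<^sup>2" by (simp add: h_def)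
    moreover have "0 \<le> (k * y)\<^sup>2" by simp
    ultimately show "0 \<le> h y" "h y \<le> 1 / 2" by (simp_all only: one_power2)
  qed
  have scale: "X\<^sup>2 * \<bar>S - X * I\<bar> = \<bar>X\<^sup>2 * S - X ^ 3 * I\<bar>" for S I
  proof -
    have "X\<^sup>2 * S - X ^ 3 * I = X\<^sup>2 * (S - X * I)"
      by (simp add: right_diff_distrib power3_eq_cube power2_eq_square)
    then show ?thesis by (simp add: abs_mult)
  qed
  have "\<bar>(\<Sum>b = 1..m. h (real b / X)) - X * integral {0..Y} h\<bar> \<le> - h Y - - h 0 + 1 / 2"
    unfolding m_def
  proof (rule riemann_sum_error[OF X])
    show "h integrable_on {0..Y}" unfolding h_def[abs_def] Y_def by (rule cone_slice_integrable)
    show "\<bar>h s - h t\<bar> \<le> - h t - - h s" if "0 \<le> s" "s \<le> t" "t \<le> Y" for s t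
      using anti that by fastforce
  qed (use Y bound in force)+
  also have "\<dots> \<le> 1" using bound[of Y] bound[of 0] Y by auto
  finally have "X\<^sup>2 * \<bar>(\<Sum>b = 1..m. h (real b / X)) - X * integral {0..Y} h\<bar> \<le> X\<^sup>2 * 1"
    by (intro mult_left_mono) auto
  then have riemann: "\<bar>(\<Sum>b = 1..m. X\<^sup>2 * h (real b / X)) - X ^ 3 * integral {0..Y} h\<bar> \<le> X\<^sup>2"
    using scale[of "\<Sum>b = 1..m. h (real b / X)" "integral {0..Y} h"] by (simp add: sum_distrib_left)
  define S where "S b = {a::nat. 0 < a \<and> k * real b \<le> real a \<and> real a \<le> X * superellipse p (real b / X)}" for b :: nat
  have "\<bar>(\<Sum>a\<in>S b. real a) - X\<^sup>2 * h (real b / X)\<bar> \<le> X" if b: "b \<in> {1..m}" for b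
  proof -
    have sl: "0 \<le> k * (real b / X)" "k * (real b / X) \<le> superellipse p (real b / X)"
      "superellipse p (real b / X) \<le> 1"
      using slice[of "real b / X"] b_Y[OF b] X by auto
    have "k * real b \<le> X * superellipse p (real b / X)" using sl(2) X by (simp add: field_simps)
    then have "\<bar>(\<Sum>a\<in>S b. real a) - ((X * superellipse p (real b / X))\<^sup>2 - (k * real b)\<^sup>2) / 2\<bar>
        \<le> X * superellipse p (real b / X)"
      using lattice_interval_sums(3)[of "k * real b" "X * superellipse p (real b / X)"] k
      by (simp add: S_def)
    also have "\<dots> \<le> X * 1" using sl X by (intro mult_left_mono) auto
    also have "((X * superellipse p (real b / X))\<^sup>2 - (k * real b)\<^sup>2) / 2 = X\<^sup>2 * h (real b / X)"
      using X by (simp add: h_def power_mult_distrib power_divide field_simps)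
    finally show ?thesis by simp
  qed
  then have "(\<Sum>b = 1..m. \<bar>(\<Sum>a\<in>S b. real a) - X\<^sup>2 * h (real b / X)\<bar>) \<le> (\<Sum>b = 1..m. X)"
    by (intro sum_mono)
  also have "\<dots> \<le> X\<^sup>2" using m X by (simp add: power2_eq_square)
  finally have slices: "\<bar>(\<Sum>b = 1..m. \<Sum>a\<in>S b. real a) - (\<Sum>b = 1..m. X\<^sup>2 * h (real b / X))\<bar> \<le> X\<^sup>2"
    using sum_abs[of "\<lambda>b. (\<Sum>a\<in>S b. real a) - X\<^sup>2 * h (real b / X)" "{1..m}"]
    by (simp add: sum_subtractf)
  have cone: "(\<Sum>(a, b)\<in>lattice_cone p X k. real a) = (\<Sum>b = 1..m. \<Sum>a\<in>S b. real a)"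
    using lattice_cone_sum[OF X k, of "\<lambda>a b. real a"] by (simp add: m_def Y_def S_def)
  have moment: "cone_moment_x p k = integral {0..Y} h"
    unfolding cone_moment_x_def Y_def h_def[abs_def] ..
  have "0 \<le> X\<^sup>2" by simp
  then show ?thesis unfolding cone moment using riemann slices by linarith
qed

text \<open>Here the slice function is \<open>y * g y\<close>, a product of an increasing and a
  decreasing factor, so it need not be monotone; \<open>V t = t - g t\<close> adds up the variations
  of the two factors, both of which take values between 0 and 1.\<close>

lemma lattice_cone_moment_y:
  assumes X: "0 < X" and k: "0 \<le> k"
  shows "\<bar>(\<Sum>(a, b)\<in>lattice_cone p X k. real b) - X ^ 3 * cone_moment_y p k\<bar> \<le> 4 * X\<^sup>2"
proof -
  define Y where "Y = cone_height p k"
  define m where "m = nat \<lfloor>X * Y\<rfloor>"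
  define g where "g y = superellipse p y - k * y" for y
  define h where "h y = y * g y" for y
  have Y: "0 < Y" "Y \<le> 1" using cone_height_bounds by (auto simp: Y_def)
  have "real m \<le> X * Y" using X Y by (simp add: m_def)
  also have "X * Y \<le> X * 1" using X Y by (intro mult_left_mono) auto
  finally have m: "real m \<le> X" by simp
  have slice: "0 \<le> k * y" "k * y \<le> superellipse p y" "superellipse p y \<le> 1" if "0 \<le> y" "y \<le> Y" for y
    using cone_slice_bounds[OF k] superellipse_bounds(2)[of y] that Y unfolding Y_def[symmetric] by auto
  have b_Y: "real b / X \<le> Y" if "b \<in> {1..m}" for b
    using that X Y by (auto simp: m_def le_nat_iff le_floor_iff field_simps)
  have anti: "g t \<le> g s" if "0 \<le> s" "s \<le> t" "t \<le> Y" for s t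
    using superellipse_antimono[of s t] mult_left_mono[of s t k] that k Y by (simp add: g_def)
  have bound: "0 \<le> g y" "g y \<le> 1" if "0 \<le> y" "y \<le> Y" for y
    using slice[OF that] by (auto simp: g_def)
  have scale: "X\<^sup>2 * \<bar>S - X * I\<bar> = \<bar>X\<^sup>2 * S - X ^ 3 * I\<bar>" for S I
  proof -
    have "X\<^sup>2 * S - X ^ 3 * I = X\<^sup>2 * (S - X * I)"
      by (simp add: right_diff_distrib power3_eq_cube power2_eq_square)
    then show ?thesis by (simp add: abs_mult)
  qed
  have "\<bar>(\<Sum>b = 1..m. h (real b / X)) - X * integral {0..Y} h\<bar> \<le> (Y - g Y) - (0 - g 0) + 1"
    unfolding m_def
  proof (rule riemann_sum_error[OF X])
    show "h integrable_on {0..Y}" unfolding h_def[abs_def] Y_def g_def by (rule cone_slice_integrable)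
    show "\<bar>h s - h t\<bar> \<le> (t - g t) - (s - g s)" if st: "0 \<le> s" "s \<le> t" "t \<le> Y" for s t
    proof -
      \<comment> \<open>A discrete product rule: a difference of two nonnegative terms, one bounded
        by the drop of \<open>g\<close> and the other by the length of the interval.\<close>
      have "h s - h t = s * (g s - g t) - (t - s) * g t" by (simp add: h_def algebra_simps)
      moreover have "0 \<le> s * (g s - g t)" "s * (g s - g t) \<le> g s - g t"
        using anti[OF st] st Y mult_right_mono[of s 1 "g s - g t"] by simp_all
      moreover have "0 \<le> (t - s) * g t" "(t - s) * g t \<le> t - s"
        using bound[of t] st mult_left_mono[of "g t" 1 "t - s"] by simp_all
      moreover have "\<bar>u - v\<bar> \<le> (t - g t) - (s - g s)"
        if "0 \<le> u" "u \<le> g s - g t" "0 \<le> v" "v \<le> t - s" for u v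
        using that st(2) anti[OF st] by (simp add: abs_le_iff)
      ultimately show ?thesis by metis
    qed
    show "\<bar>h t\<bar> \<le> 1" if "0 \<le> t" "t \<le> Y" for t
      using mult_mono[of t 1 "g t" 1] bound[OF that] that Y by (simp add: h_def)
  qed (use Y in simp)
  also have "\<dots> \<le> 3" using bound[of Y] bound[of 0] Y by auto
  finally have "X\<^sup>2 * \<bar>(\<Sum>b = 1..m. h (real b / X)) - X * integral {0..Y} h\<bar> \<le> X\<^sup>2 * 3"
    by (intro mult_left_mono) auto
  then have riemann: "\<bar>(\<Sum>b = 1..m. X\<^sup>2 * h (real b / X)) - X ^ 3 * integral {0..Y} h\<bar> \<le> X\<^sup>2 * 3"
    using scale[of "\<Sum>b = 1..m. h (real b / X)" "integral {0..Y} h"] by (simp add: sum_distrib_left)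
  define S where "S b = {a::nat. 0 < a \<and> k * real b \<le> real a \<and> real a \<le> X * superellipse p (real b / X)}" for b :: nat
  have "\<bar>(\<Sum>a\<in>S b. real b) - X\<^sup>2 * h (real b / X)\<bar> \<le> X" if b: "b \<in> {1..m}" for b
  proof -
    have sl: "0 \<le> k * (real b / X)" "k * (real b / X) \<le> superellipse p (real b / X)"
      "superellipse p (real b / X) \<le> 1"
      using slice[of "real b / X"] b_Y[OF b] X by auto
    have "k * real b \<le> X * superellipse p (real b / X)" using sl(2) X by (simp add: field_simps)
    then have "\<bar>real (card (S b)) - (X * superellipse p (real b / X) - k * real b)\<bar> \<le> 1"
      using lattice_interval_sums(2)[of "k * real b" "X * superellipse p (real b / X)"] k
      by (simp add: S_def)
    then have "real b * \<bar>real (card (S b)) - (X * superellipse p (real b / X) - k * real b)\<bar> \<le> real b * 1"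
      by (intro mult_left_mono) auto
    also have "\<dots> \<le> X" using b m by auto
    finally have "\<bar>real b * real (card (S b)) - real b * (X * superellipse p (real b / X) - k * real b)\<bar> \<le> X"
      by (simp add: abs_mult flip: right_diff_distrib)
    moreover have "real b * (X * superellipse p (real b / X) - k * real b) = X\<^sup>2 * h (real b / X)"
      using X by (simp add: h_def g_def power2_eq_square field_simps)
    ultimately show ?thesis by (simp add: mult.commute)
  qed
  then have "(\<Sum>b = 1..m. \<bar>(\<Sum>a\<in>S b. real b) - X\<^sup>2 * h (real b / X)\<bar>) \<le> (\<Sum>b = 1..m. X)"
    by (intro sum_mono)
  also have "\<dots> \<le> X\<^sup>2" using m X by (simp add: power2_eq_square)
  finally have slices: "\<bar>(\<Sum>b = 1..m. \<Sum>a\<in>S b. real b) - (\<Sum>b = 1..m. X\<^sup>2 * h (real b / X))\<bar> \<le> X\<^sup>2"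
    using sum_abs[of "\<lambda>b. (\<Sum>a\<in>S b. real b) - X\<^sup>2 * h (real b / X)" "{1..m}"]
    by (simp add: sum_subtractf)
  have cone: "(\<Sum>(a, b)\<in>lattice_cone p X k. real b) = (\<Sum>b = 1..m. \<Sum>a\<in>S b. real b)"
    using lattice_cone_sum[OF X k, of "\<lambda>a b. real b"] by (simp add: m_def Y_def S_def)
  have moment: "cone_moment_y p k = integral {0..Y} h"
    unfolding cone_moment_y_def Y_def h_def[abs_def] g_def ..
  show ?thesis unfolding cone moment using riemann slices by linarith
qed

end

section \<open>Primitive lattice points\<close>

text \<open>A contraction argument in place of Moebius inversion: moving all terms but the first to the
  right-hand side bounds the upper limit of \<open>\<bar>s\<bar>\<close> by \<open>\<pi>\<^sup>2 / 6 - 1 < 1\<close> times itself.\<close>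

lemma vanishing_of_divisor_sums:
  fixes s \<delta> :: "real \<Rightarrow> 'i \<Rightarrow> real"
  assumes B: "0 < B" "\<And>X i. 0 < X \<Longrightarrow> i \<in> I \<Longrightarrow> \<bar>s X i\<bar> \<le> B"
    and sums: "\<And>X i. 0 < X \<Longrightarrow> i \<in> I \<Longrightarrow> (\<lambda>d. s (X / real (Suc d)) i / (real (Suc d))\<^sup>2) sums \<delta> X i"
    and C: "0 < C" "\<And>X i. 0 < X \<Longrightarrow> i \<in> I \<Longrightarrow> \<bar>\<delta> X i\<bar> \<le> C / X"
    and "0 < \<epsilon>"
  shows "\<exists>X0>0. \<forall>X\<ge>X0. \<forall>i\<in>I. \<bar>s X i\<bar> \<le> \<epsilon>"
proof -
  define g where "g d = 1 / (real (Suc (Suc d)))\<^sup>2" for d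
  have "(\<lambda>d. 1 / (real (Suc d))\<^sup>2) sums (pi\<^sup>2 / 6)"
    using inverse_squares_sums by (simp add: add.commute)
  then have g_sums: "g sums (pi\<^sup>2 / 6 - 1)"
    using sums_Suc_iff[of "\<lambda>d. 1 / (real (Suc d))\<^sup>2" "pi\<^sup>2 / 6 - 1"] by (simp add: g_def[abs_def])
  have "pi\<^sup>2 \<le> (16/5)\<^sup>2" using pi_approx by (intro power_mono) auto
  then have q: "suminf g \<le> 71/100" using g_sums by (simp add: sums_unique[symmetric] power2_eq_square)
  have g0: "0 \<le> g d" for d by (simp add: g_def)
  have summ: "summable g" using g_sums by (rule sums_summable)
  \<comment> \<open>Since \<open>pi \<le> 16/5\<close>, the weights from the second term on have sum
    at most 71/100. The factor 4/5 leaves room for two errors of \<open>A / 25\<close>: the tail of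
    the series, where only the crude bound \<open>B\<close> is available, and
    \<open>\<delta>\<close>, which is small for large \<open>X\<close>. The first \<open>D\<close>
    terms have arguments at least \<open>X0\<close>, so \<open>A\<close> applies to them.\<close>
  have improve: "\<exists>X1>0. \<forall>X\<ge>X1. \<forall>i\<in>I. \<bar>s X i\<bar> \<le> (4/5) * A"
    if A: "0 < A" and X0: "0 < X0" "\<forall>X\<ge>X0. \<forall>i\<in>I. \<bar>s X i\<bar> \<le> A" for A X0
  proof -
    define r where "r = (1/25) * A / B"
    have "0 < r" using A B by (simp add: r_def)
    then obtain D where D: "norm (\<Sum>d. g (d + D)) < r"
      using suminf_exist_split[OF _ summ] by blast
    define X1 where "X1 = max (real (Suc (Suc D)) * X0) (C / ((1/25) * A))"
    have "0 < X1" using X0 by (simp add: X1_def less_max_iff_disj)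
    moreover have "\<bar>s X i\<bar> \<le> (4/5) * A" if X: "X1 \<le> X" and i: "i \<in> I" for X i
    proof -
      have Xpos: "0 < X" using \<open>0 < X1\<close> X by linarith
      define f where "f d = s (X / real (Suc (Suc d))) i / (real (Suc (Suc d)))\<^sup>2" for d
      have f_sums: "f sums (\<delta> X i - s X i)"
        using sums[OF Xpos i] sums_Suc_iff[of "\<lambda>d. s (X / real (Suc d)) i / (real (Suc d))\<^sup>2" "\<delta> X i - s X i"]
        by (simp add: f_def[abs_def])
      have f_le: "\<bar>f d\<bar> \<le> B * g d" for d
        using B(2)[of "X / real (Suc (Suc d))" i] Xpos i
        by (simp add: f_def g_def abs_divide divide_right_mono)
      have f_le_A: "\<bar>f d\<bar> \<le> A * g d" if "d < D" for d
      proof -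
        have "real (Suc (Suc d)) * X0 \<le> real (Suc (Suc D)) * X0"
          using that X0 by (intro mult_right_mono) auto
        also have "\<dots> \<le> X" using X by (simp add: X1_def)
        finally have "X0 \<le> X / real (Suc (Suc d))" by (simp add: le_divide_eq mult.commute)
        then have "\<bar>s (X / real (Suc (Suc d))) i\<bar> \<le> A" using X0 i by blast
        then show ?thesis by (simp add: f_def g_def abs_divide divide_right_mono)
      qed
      have summ_f: "summable f" using f_sums by (rule sums_summable)
      have tail_summ: "summable (\<lambda>d. B * g (d + D))"
        using summ by (intro summable_mult) (simp add: summable_iff_shift)
      have "\<bar>\<Sum>d<D. f d\<bar> \<le> (\<Sum>d<D. A * g d)"
        by (rule order_trans[OF sum_abs]) (intro sum_mono f_le_A, auto)
      also have "\<dots> = A * (\<Sum>d<D. g d)" by (simp add: sum_distrib_left)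
      also have "\<dots> \<le> A * (71/100)"
        using A q sum_le_suminf[OF summ, of "{..<D}"] g0 by (intro mult_left_mono) auto
      finally have head: "\<bar>\<Sum>d<D. f d\<bar> \<le> A * (71/100)" .
      have "norm (\<Sum>d. f (d + D)) \<le> (\<Sum>d. B * g (d + D))"
        using f_le tail_summ by (intro norm_suminf_le) auto
      also have "\<dots> = B * (\<Sum>d. g (d + D))"
        using summ by (intro suminf_mult) (simp add: summable_iff_shift)
      also have "\<dots> \<le> B * r" using D B by (intro mult_left_mono) auto
      also have "\<dots> = (1/25) * A" using B by (simp add: r_def)
      finally have tail: "\<bar>\<Sum>d. f (d + D)\<bar> \<le> (1/25) * A" by simp
      have "\<delta> X i - s X i = (\<Sum>d. f (d + D)) + (\<Sum>d<D. f d)"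
        using suminf_split_initial_segment[OF summ_f] f_sums by (simp add: sums_unique[symmetric])
      moreover have "C / ((1/25) * A) \<le> X" using X by (simp add: X1_def)
      then have "C / X \<le> (1/25) * A" using A Xpos by (simp add: field_simps)
      then have "\<bar>\<delta> X i\<bar> \<le> (1/25) * A" using C(2)[OF Xpos i] by linarith
      ultimately show ?thesis using head tail A by linarith
    qed
    ultimately show ?thesis by blast
  qed
  have iter: "\<exists>X0>0. \<forall>X\<ge>X0. \<forall>i\<in>I. \<bar>s X i\<bar> \<le> (4/5) ^ n * B" for n
  proof (induction n)
    case 0
    show ?case using B by (intro exI[of _ 1]) auto
  next
    case (Suc n)
    then obtain X0 where X0: "0 < X0" "\<forall>X\<ge>X0. \<forall>i\<in>I. \<bar>s X i\<bar> \<le> (4/5) ^ n * B" by blast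
    have "0 < (4/5) ^ n * B" using B by simp
    from improve[OF this X0] show ?case by (simp add: mult.assoc)
  qed
  obtain n where "(4/5::real) ^ n < \<epsilon> / B"
    using real_arch_pow_inv[of "\<epsilon> / B" "4/5"] B \<open>0 < \<epsilon>\<close> by auto
  then have n: "(4/5) ^ n * B \<le> \<epsilon>" using B by (simp add: field_simps)
  from iter[of n] obtain X0 where "0 < X0" "\<forall>X\<ge>X0. \<forall>i\<in>I. \<bar>s X i\<bar> \<le> (4/5) ^ n * B" by blast
  then show ?thesis using n by (intro exI[of _ X0]) force
qed

context positive_exponent
begin

definition primitive_cone :: "real \<Rightarrow> real \<Rightarrow> (nat \<times> nat) set" where
  "primitive_cone X k = {(a, b) \<in> lattice_cone p X k. coprime a b}"

lemma lattice_cone_le: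
  assumes "0 < X" "(a, b) \<in> lattice_cone p X k"
  shows "real a \<le> X" "real b \<le> X"
proof -
  have ab: "(real a / X) powr p + (real b / X) powr p \<le> 1" using assms by (simp add: lattice_cone_def)
  have "(real a / X) powr p \<le> 1" "(real b / X) powr p \<le> 1"
    using ab powr_ge_zero[of "real a / X" p] powr_ge_zero[of "real b / X" p] by linarith+
  then show "real a \<le> X" "real b \<le> X" using le_one_if_powr_le_one[of "real a / X"] le_one_if_powr_le_one[of "real b / X"] assms by auto
qed

lemma lattice_cone_scale:
  assumes "0 < d"
  shows "(d * a, d * b) \<in> lattice_cone p X k \<longleftrightarrow> (a, b) \<in> lattice_cone p (X / real d) k"
  using assms by (simp add: lattice_cone_def field_simps)

text \<open>The lattice points are grouped by their gcd \<open>d\<close>: dividing by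
  \<open>d\<close> shrinks the dilation to \<open>X / d\<close>, and homogeneity of \<open>w\<close>
  takes out the factor \<open>d\<close>. The gcd is at most the first coordinate, hence at most
  \<open>X\<close>.\<close>

lemma lattice_cone_primitive_sum:
  assumes X: "0 < X" and k: "0 \<le> k" and w: "\<And>d a b. w (d * a, d * b) = real d * w (a, b)"
  shows "sum w (lattice_cone p X k) = (\<Sum>d = 1..nat \<lfloor>X\<rfloor>. real d * sum w (primitive_cone (X / real d) k))"
proof -
  define D where "D = nat \<lfloor>X\<rfloor>"
  have "(\<lambda>(a, b). gcd a b) ` lattice_cone p X k \<subseteq> {1..D}"
  proof clarify
    fix a b assume ab: "(a, b) \<in> lattice_cone p X k"
    then have "0 < a" by (simp add: lattice_cone_def)
    moreover have "a \<le> D" using lattice_cone_le(1)[OF X ab] by (simp add: D_def le_nat_floor)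
    ultimately show "gcd a b \<in> {1..D}" using order_trans[OF gcd_le1_nat[of a b]] by (auto simp: Suc_le_eq)
  qed
  then have "sum w (lattice_cone p X k)
      = (\<Sum>d = 1..D. sum w {v \<in> lattice_cone p X k. (\<lambda>(a, b). gcd a b) v = d})"
    using finite_lattice_cone[OF X k] by (intro sum.group[symmetric]) auto
  also have "\<dots> = (\<Sum>d = 1..D. real d * sum w (primitive_cone (X / real d) k))"
  proof (rule sum.cong)
    fix d assume "d \<in> {1..D}"
    then have d: "0 < d" by simp
    have "sum w {v \<in> lattice_cone p X k. (\<lambda>(a, b). gcd a b) v = d}
      = (\<Sum>(a, b)\<in>primitive_cone (X / real d) k. real d * w (a, b))"
    proof (rule sum.reindex_bij_witness[of _ "\<lambda>(a, b). (d * a, d * b)" "\<lambda>(a, b). (a div d, b div d)"])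
      fix v assume v: "v \<in> {v \<in> lattice_cone p X k. (\<lambda>(a, b). gcd a b) v = d}"
      obtain a b where "v = (a, b)" by (cases v)
      then have ab: "v = (a, b)" "(a, b) \<in> lattice_cone p X k" "gcd a b = d" using v by auto
      then have dvd: "d * (a div d) = a" "d * (b div d) = b" by auto
      have "coprime (a div d) (b div d)" using ab d div_gcd_coprime[of a b] by auto
      then show "(case v of (a, b) \<Rightarrow> (a div d, b div d)) \<in> primitive_cone (X / real d) k"
        using lattice_cone_scale[OF d, of "a div d" "b div d" X k] ab dvd by (simp add: primitive_cone_def)
      show "(\<lambda>(a, b). (d * a, d * b)) (case v of (a, b) \<Rightarrow> (a div d, b div d)) = v"
        using ab dvd by simp
      show "(case case v of (a, b) \<Rightarrow> (a div d, b div d) of (a, b) \<Rightarrow> real d * w (a, b)) = w v"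
        using ab dvd w[of d "a div d" "b div d"] by simp
    next
      fix v assume v: "v \<in> primitive_cone (X / real d) k"
      then show "(\<lambda>(a, b). (a div d, b div d)) (case v of (a, b) \<Rightarrow> (d * a, d * b)) = v"
        using d by (cases v) auto
      show "(case v of (a, b) \<Rightarrow> (d * a, d * b)) \<in> {v \<in> lattice_cone p X k. (\<lambda>(a, b). gcd a b) v = d}"
        using v d lattice_cone_scale[OF d] by (auto simp: primitive_cone_def gcd_mult_distrib_nat[symmetric])
    qed
    then show "sum w {v \<in> lattice_cone p X k. (\<lambda>(a, b). gcd a b) v = d}
      = real d * sum w (primitive_cone (X / real d) k)"
      by (simp add: sum_distrib_left split_def)
  qed simp
  finally show ?thesis by (simp add: D_def)
qed

lemma primitive_cone_empty:
  assumes "0 < X" "X < 1"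
  shows "primitive_cone X k = {}" "lattice_cone p X k = {}"
proof -
  show "lattice_cone p X k = {}"
    using lattice_cone_le(1)[OF assms(1)] assms(2) by (fastforce simp: lattice_cone_def)
  then show "primitive_cone X k = {}" by (auto simp: primitive_cone_def)
qed

text \<open>After division by the cube of the dilation, the grouping by gcd has weights
  \<open>1 / d\<^sup>2\<close>, and the proposed constants \<open>6 / pi\<^sup>2 * G k\<close> add
  up to \<open>G k\<close>. The normalized errors therefore satisfy the hypothesis of
  \<open>vanishing_of_divisor_sums\<close>, with right-hand side the lattice error of order
  \<open>1 / X\<close>. Taking \<open>k\<close> as the index of the family there keeps everything
  uniform in \<open>k\<close>.\<close>

lemma primitive_cone_asymptotics:
  fixes w :: "nat \<times> nat \<Rightarrow> real" and G :: "real \<Rightarrow> real"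
  assumes w: "\<And>d a b. w (d * a, d * b) = real d * w (a, b)" "\<And>v. 0 \<le> w v"
    and G: "\<And>k. 0 \<le> k \<Longrightarrow> \<bar>G k\<bar> \<le> M" "0 \<le> M"
    and N: "\<And>X k. 0 < X \<Longrightarrow> 0 \<le> k \<Longrightarrow> \<bar>sum w (lattice_cone p X k) - X ^ 3 * G k\<bar> \<le> C * X\<^sup>2"
    and C: "0 < C" and "0 < \<epsilon>"
  shows "\<exists>X0>0. \<forall>X\<ge>X0. \<forall>k\<in>{0..}. \<bar>sum w (primitive_cone X k) / X ^ 3 - 6 / pi\<^sup>2 * G k\<bar> \<le> \<epsilon>"
proof (rule vanishing_of_divisor_sums[where \<delta> = "\<lambda>X k. sum w (lattice_cone p X k) / X ^ 3 - G k"])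
  have c: "6 / pi\<^sup>2 \<le> 1" using pi_gt3 power_mono[of 3 pi 2] by (simp add: field_simps)
  show "0 < 2 * M + C" using G C by simp
  show "\<bar>sum w (primitive_cone X k) / X ^ 3 - 6 / pi\<^sup>2 * G k\<bar> \<le> 2 * M + C" if X: "0 < X" and k: "k \<in> {0..}" for X k
  proof -
    have "\<bar>6 / pi\<^sup>2 * G k\<bar> \<le> 1 * M" unfolding abs_mult using G k c by (intro mult_mono) auto
    moreover have "0 \<le> sum w (primitive_cone X k) / X ^ 3" using X w by (auto intro!: divide_nonneg_pos sum_nonneg)
    moreover have "sum w (primitive_cone X k) / X ^ 3 \<le> M + C"
    \<comment> \<open>Below 1 the cone is empty; from 1 on the cube of \<open>X\<close> dominates
      its square and absorbs the error term.\<close>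
    proof (cases "X < 1")
      case True
      then show ?thesis using X primitive_cone_empty(1)[of X k] G C by simp
    next
      case False
      have "sum w (primitive_cone X k) \<le> sum w (lattice_cone p X k)"
        using finite_lattice_cone[of X k] X k w by (intro sum_mono2) (auto simp: primitive_cone_def)
      also have "\<dots> \<le> X ^ 3 * G k + C * X\<^sup>2" using N[of X k] X k by auto
      also have "\<dots> \<le> X ^ 3 * M + C * X ^ 3"
        using G(1)[of k] k X False C by (intro add_mono mult_left_mono power_increasing) auto
      finally show ?thesis using X by (simp add: field_simps)
    qed
    ultimately show ?thesis by linarith
  qed
  show "\<bar>sum w (lattice_cone p X k) / X ^ 3 - G k\<bar> \<le> C / X" if X: "0 < X" and k: "k \<in> {0..}" for X k
  proof -
    have "sum w (lattice_cone p X k) / X ^ 3 - G k = (sum w (lattice_cone p X k) - X ^ 3 * G k) / X ^ 3"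
      using X by (simp add: field_simps)
    then have "\<bar>sum w (lattice_cone p X k) / X ^ 3 - G k\<bar> \<le> C * X\<^sup>2 / X ^ 3"
      using N[of X k] X k by (simp add: abs_divide divide_right_mono)
    then show ?thesis using X by (simp add: power2_eq_square power3_eq_cube)
  qed
  show "(\<lambda>d. (sum w (primitive_cone (X / real (Suc d)) k) / (X / real (Suc d)) ^ 3 - 6 / pi\<^sup>2 * G k) / (real (Suc d))\<^sup>2)
     sums (sum w (lattice_cone p X k) / X ^ 3 - G k)" if X: "0 < X" and k: "k \<in> {0..}" for X k
  proof -
    have "(\<lambda>d. 6 / pi\<^sup>2 * G k * (1 / (real (Suc d))\<^sup>2)) sums (6 / pi\<^sup>2 * G k * (pi\<^sup>2 / 6))"
      using inverse_squares_sums by (intro sums_mult) (simp add: add.commute)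
    then have 1: "(\<lambda>d. 6 / pi\<^sup>2 * G k / (real (Suc d))\<^sup>2) sums G k" by simp
    define f where "f d = sum w (primitive_cone (X / real (Suc d)) k) / (X / real (Suc d)) ^ 3 / (real (Suc d))\<^sup>2" for d
    have "f d = 0" if "d \<notin> {..<nat \<lfloor>X\<rfloor>}" for d
    proof -
      have "X < real (Suc d)" using that X by (simp add: not_less) linarith
      then show ?thesis using primitive_cone_empty(1)[of "X / real (Suc d)" k] X by (simp add: f_def)
    qed
    then have "f sums (\<Sum>d<nat \<lfloor>X\<rfloor>. f d)" by (intro sums_finite) auto
    also have "(\<Sum>d<nat \<lfloor>X\<rfloor>. f d) = (\<Sum>d<nat \<lfloor>X\<rfloor>. real (Suc d) * sum w (primitive_cone (X / real (Suc d)) k) / X ^ 3)"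
    proof (intro sum.cong refl)
      have "T / (X / u) ^ 3 / u\<^sup>2 = u * T / X ^ 3" if "0 < u" for T u
        using that by (simp add: power_divide power2_eq_square power3_eq_cube mult.assoc)
      then show "f d = real (Suc d) * sum w (primitive_cone (X / real (Suc d)) k) / X ^ 3" for d
        by (simp only: f_def of_nat_0_less_iff zero_less_Suc)
    qed
    also have "\<dots> = (\<Sum>d<nat \<lfloor>X\<rfloor>. real (Suc d) * sum w (primitive_cone (X / real (Suc d)) k)) / X ^ 3"
      by (simp add: sum_divide_distrib)
    also have "(\<Sum>d<nat \<lfloor>X\<rfloor>. real (Suc d) * sum w (primitive_cone (X / real (Suc d)) k))
        = (\<Sum>d = 1..nat \<lfloor>X\<rfloor>. real d * sum w (primitive_cone (X / real d) k))"
      by (rule sum.reindex_bij_witness[of _ "\<lambda>d. d - 1" Suc]) auto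
    also have "\<dots> = sum w (lattice_cone p X k)"
      using lattice_cone_primitive_sum[OF X, of k w] k w(1) by auto
    finally have "f sums (sum w (lattice_cone p X k) / X ^ 3)" .
    from sums_diff[OF this 1] show ?thesis by (simp add: f_def diff_divide_distrib)
  qed
qed (use C \<open>0 < \<epsilon>\<close> in auto)

end

section \<open>Incomplete beta functions\<close>

context positive_exponent
begin

text \<open>The substitution \<open>y = u powr (1 / p)\<close>. Its derivative may blow up at
  \<open>u = 0\<close>, so that point is made the exceptional set of the substitution rule.\<close>

lemma integral_powr_substitution:
  fixes f :: "real \<Rightarrow> real"
  assumes f: "continuous_on {0..1} f" and m: "0 \<le> m" "m \<le> 1"
  shows "((\<lambda>u. (1 / p * u powr (1 / p - 1)) * f (u powr (1 / p))) has_integral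
    integral {0..m powr (1 / p)} f) {0..m}"
proof -
  have "((\<lambda>u. (1 / p * u powr (1 / p - 1)) *\<^sub>R f (u powr (1 / p))) has_integral
      integral {0 powr (1 / p)..m powr (1 / p)} f) {0..m}"
  proof (rule has_integral_substitution_strong[where s = "{0}" and c = 0 and d = 1])
    show "0 powr (1 / p) \<le> m powr (1 / p)" by simp
    show "(\<lambda>u. u powr (1 / p)) ` {0..m} \<subseteq> {0..1}"
      using m p powr_mono2[of "1 / p" _ 1] by force
    show "continuous_on {0..m} (\<lambda>u. u powr (1 / p))"
      using p by (intro continuous_on_powr' continuous_intros) auto
    show "((\<lambda>u. u powr (1 / p)) has_field_derivative 1 / p * u powr (1 / p - 1)) (at u within {0..m})"
      if "u \<in> {0..m} - {0}" for u
      using that by (auto intro!: derivative_eq_intros)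
  qed (use m f in auto)
  then show ?thesis by simp
qed

lemma superellipse_integrals:
  assumes m: "0 \<le> m" "m \<le> 1"
  shows "integral {0..m powr (1 / p)} (\<lambda>y. (superellipse p y)\<^sup>2) = incomplete_beta m (1 / p) (1 + 2 / p) / p"
    and "integral {0..m powr (1 / p)} (\<lambda>y. y * superellipse p y) = incomplete_beta m (2 / p) (1 + 1 / p) / p"
proof -
  have sub: "superellipse p (u powr (1 / p)) = (1 - u) powr (1 / p)" if "0 \<le> u" for u
    using that p by (simp add: superellipse_def powr_powr)
  have "((\<lambda>u. (1 / p * u powr (1 / p - 1)) * (superellipse p (u powr (1 / p)))\<^sup>2) has_integral
      integral {0..m powr (1 / p)} (\<lambda>y. (superellipse p y)\<^sup>2)) {0..m}"
    by (rule integral_powr_substitution[OF _ m]) (intro continuous_intros continuous_on_superellipse)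
  then have "((\<lambda>u. p * ((1 / p * u powr (1 / p - 1)) * (superellipse p (u powr (1 / p)))\<^sup>2)) has_integral
      p * integral {0..m powr (1 / p)} (\<lambda>y. (superellipse p y)\<^sup>2)) {0..m}"
    by (rule has_integral_mult_right)
  moreover have "p * ((1 / p * u powr (1 / p - 1)) * (superellipse p (u powr (1 / p)))\<^sup>2)
      = u powr (1 / p - 1) * (1 - u) powr ((1 + 2 / p) - 1)" if "u \<in> {0..m}" for u
    using p that by (simp add: sub power2_eq_square flip: powr_add)
  ultimately have "((\<lambda>u. u powr (1 / p - 1) * (1 - u) powr ((1 + 2 / p) - 1)) has_integral
      p * integral {0..m powr (1 / p)} (\<lambda>y. (superellipse p y)\<^sup>2)) {0..m}"
    by (rule has_integral_eq[rotated]) auto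
  then show "integral {0..m powr (1 / p)} (\<lambda>y. (superellipse p y)\<^sup>2) = incomplete_beta m (1 / p) (1 + 2 / p) / p"
    using p unfolding incomplete_beta_def by (simp add: integral_unique)
  have "((\<lambda>u. (1 / p * u powr (1 / p - 1)) * (u powr (1 / p) * superellipse p (u powr (1 / p)))) has_integral
      integral {0..m powr (1 / p)} (\<lambda>y. y * superellipse p y)) {0..m}"
    by (rule integral_powr_substitution[OF _ m]) (intro continuous_intros continuous_on_superellipse)
  then have "((\<lambda>u. p * ((1 / p * u powr (1 / p - 1)) * (u powr (1 / p) * superellipse p (u powr (1 / p))))) has_integral
      p * integral {0..m powr (1 / p)} (\<lambda>y. y * superellipse p y)) {0..m}"
    by (rule has_integral_mult_right)
  moreover have "p * ((1 / p * u powr (1 / p - 1)) * (u powr (1 / p) * superellipse p (u powr (1 / p))))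
      = u powr (2 / p - 1) * (1 - u) powr ((1 + 1 / p) - 1)" if "u \<in> {0..m}" for u
  proof -
    have "u powr (1 / p - 1) * u powr (1 / p) = u powr (2 / p - 1)"
      by (simp flip: powr_add)
    then show ?thesis using p that by (simp add: sub flip: mult.assoc)
  qed
  ultimately have "((\<lambda>u. u powr (2 / p - 1) * (1 - u) powr ((1 + 1 / p) - 1)) has_integral
      p * integral {0..m powr (1 / p)} (\<lambda>y. y * superellipse p y)) {0..m}"
    by (rule has_integral_eq[rotated]) auto
  then show "integral {0..m powr (1 / p)} (\<lambda>y. y * superellipse p y) = incomplete_beta m (2 / p) (1 + 1 / p) / p"
    using p unfolding incomplete_beta_def by (simp add: integral_unique)
qed

lemma integral_square: "0 \<le> c \<Longrightarrow> integral {0..c} (\<lambda>y::real. y\<^sup>2) = c ^ 3 / 3"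
proof (rule integral_unique)
  assume c: "0 \<le> c"
  have "((\<lambda>y. y\<^sup>2) has_integral c ^ 3 / 3 - 0 ^ 3 / 3) {0..c}"
    by (rule fundamental_theorem_of_calculus[OF c])
      (auto intro!: derivative_eq_intros simp flip: has_real_derivative_iff_has_vector_derivative)
  then show "((\<lambda>y. y\<^sup>2) has_integral c ^ 3 / 3) {0..c}" by simp
qed

lemma cone_moments:
  "cone_moment_x p k = (integral {0..cone_height p k} (\<lambda>y. (superellipse p y)\<^sup>2)
      - k\<^sup>2 * (cone_height p k) ^ 3 / 3) / 2"
  "cone_moment_y p k = integral {0..cone_height p k} (\<lambda>y. y * superellipse p y)
      - k * (cone_height p k) ^ 3 / 3"
proof -
  define Y where "Y = cone_height p k"
  have Y: "0 < Y" "Y \<le> 1" using cone_height_bounds by (auto simp: Y_def)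
  have c: "continuous_on {0..Y} (superellipse p)"
    using continuous_on_superellipse by (rule continuous_on_subset) (use Y in auto)
  have "integral {0..Y} (\<lambda>y. (superellipse p y)\<^sup>2 - (k * y)\<^sup>2)
      = integral {0..Y} (\<lambda>y. (superellipse p y)\<^sup>2) - integral {0..Y} (\<lambda>y. (k * y)\<^sup>2)"
    by (intro integral_diff integrable_continuous_real continuous_intros c)
  also have "integral {0..Y} (\<lambda>y. (k * y)\<^sup>2) = k\<^sup>2 * (Y ^ 3 / 3)"
    using Y by (simp add: power_mult_distrib integral_square)
  finally show "cone_moment_x p k = (integral {0..cone_height p k} (\<lambda>y. (superellipse p y)\<^sup>2)
      - k\<^sup>2 * (cone_height p k) ^ 3 / 3) / 2"
    unfolding cone_moment_x_def Y_def[symmetric] by simp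
  have "cone_moment_y p k = integral {0..Y} (\<lambda>y. y * superellipse p y - k * y\<^sup>2)"
    unfolding cone_moment_y_def Y_def[symmetric] by (simp add: algebra_simps power2_eq_square)
  also have "\<dots> = integral {0..Y} (\<lambda>y. y * superellipse p y) - integral {0..Y} (\<lambda>y. k * y\<^sup>2)"
    by (intro integral_diff integrable_continuous_real continuous_intros c)
  also have "integral {0..Y} (\<lambda>y. k * y\<^sup>2) = k * (Y ^ 3 / 3)"
    using Y by (simp add: integral_square)
  finally show "cone_moment_y p k = integral {0..cone_height p k} (\<lambda>y. y * superellipse p y)
      - k * (cone_height p k) ^ 3 / 3"
    unfolding Y_def[symmetric] by simp
qed

text \<open>Raising one argument \<open>b\<close> of \<open>Beta a b\<close> by 1 multiplies it by
  \<open>b / (a + b)\<close>; with arguments \<open>1 / p\<close> and \<open>2 / p\<close> this is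
  2/3 or 1/3. The two differently regularized coordinates of the arc thus share one normalizing
  constant.\<close>

lemma Beta_facts:
  "0 < Beta (1 / p) (2 / p)"
  "Beta (1 / p) (1 + 2 / p) = 2 / 3 * Beta (1 / p) (2 / p)"
  "Beta (2 / p) (1 + 1 / p) = 1 / 3 * Beta (1 / p) (2 / p)"
proof -
  have "x \<notin> \<int>\<^sub>\<le>\<^sub>0" if "0 < x" for x :: real using that by (auto elim!: nonpos_Ints_cases)
  then have np: "1 / p \<notin> \<int>\<^sub>\<le>\<^sub>0" "2 / p \<notin> \<int>\<^sub>\<le>\<^sub>0" using p by simp_all
  show "0 < Beta (1 / p) (2 / p)" using p by (simp add: Beta_def Gamma_real_pos add_pos_pos)
  show "Beta (1 / p) (1 + 2 / p) = 2 / 3 * Beta (1 / p) (2 / p)"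
    using Beta_plus1_right[OF np(2), of "1 / p"] p by (simp add: field_simps add.commute)
  show "Beta (2 / p) (1 + 1 / p) = 1 / 3 * Beta (1 / p) (2 / p)"
    using Beta_plus1_right[OF np(1), of "2 / p"] p by (simp add: field_simps add.commute Beta_commute)
qed

lemma cone_moment_x_zero: "cone_moment_x p 0 = Beta (1 / p) (2 / p) / (3 * p)"
proof -
  have "cone_height p 0 = 1 powr (1 / p)" using p by (simp add: cone_height_def)
  then have "cone_moment_x p 0 = incomplete_beta 1 (1 / p) (1 + 2 / p) / p / 2"
    using superellipse_integrals(1)[of 1] by (simp add: cone_moments)
  also have "incomplete_beta 1 (1 / p) (1 + 2 / p) = Beta (1 / p) (1 + 2 / p)"
    unfolding incomplete_beta_def
    by (rule integral_unique[OF has_integral_Beta_real]) (use p in \<open>auto intro: add_pos_pos\<close>)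
  finally show ?thesis by (simp add: Beta_facts)
qed

text \<open>The parameter \<open>l\<close> is the slope of the edge direction, so the cone has
  \<open>k = 1 / l\<close>, and its height to the power \<open>p\<close> is the argument of the
  incomplete beta functions. The subtracted terms of the arc are the moments of the triangle to the
  left of the ray \<open>x = k * y\<close>, which are multiples of the cube of the height.\<close>

lemma limit_arc_point_eq:
  assumes l: "0 < l"
  shows "limit_arc_point p l = (cone_moment_x p (1 / l) / cone_moment_x p 0,
    cone_moment_y p (1 / l) / cone_moment_x p 0 - 1)"
proof -
  define m where "m = l powr p / (1 + l powr p)"
  define Y where "Y = cone_height p (1 / l)"
  define W where "W = (1 + l powr p) powr (- 3 / p)"
  define B where "B = Beta (1 / p) (2 / p)"
  have lp: "0 < l powr p" "0 < 1 + l powr p" using l by (simp_all add: add_pos_pos)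
  have m: "0 \<le> m" "m \<le> 1" using lp by (auto simp: m_def)
  have B: "0 < B" using Beta_facts by (simp add: B_def)
  have "Y powr p = m"
    using lp l by (simp add: Y_def cone_height_powr m_def powr_divide field_simps)
  then have Ym: "m powr (1 / p) = Y"
    using cone_height_bounds(1)[of "1 / l"] p by (auto simp: Y_def powr_powr)
  have "Y = l / (1 + l powr p) powr (1 / p)"
    using lp l p by (simp add: m_def powr_divide powr_powr flip: Ym)
  moreover have "((1 + l powr p) powr (1 / p)) ^ 3 = (1 + l powr p) powr (3 / p)"
    using lp by (simp add: power3_eq_cube flip: powr_add)
  ultimately have Y3: "Y ^ 3 = l ^ 3 * W"
    by (simp add: W_def power_divide powr_minus_divide)
  have kY: "(1 / l)\<^sup>2 * Y ^ 3 = l * W" "1 / l * Y ^ 3 = l\<^sup>2 * W"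
    unfolding Y3 using l by (simp_all add: power2_eq_square power3_eq_cube)
  have x: "cone_moment_x p (1 / l) = (incomplete_beta m (1 / p) (1 + 2 / p) / p - l * W / 3) / 2"
    unfolding cone_moments Y_def[symmetric] kY superellipse_integrals(1)[OF m, unfolded Ym] ..
  have y: "cone_moment_y p (1 / l) = incomplete_beta m (2 / p) (1 + 1 / p) / p - l\<^sup>2 * W / 3"
    unfolding cone_moments Y_def[symmetric] kY superellipse_integrals(2)[OF m, unfolded Ym] ..
  show ?thesis
    unfolding limit_arc_point_def Let_def m_def[symmetric] W_def[symmetric] regularized_beta_def
      Beta_facts(2,3) cone_moment_x_zero x y B_def[symmetric]
    using B p by (simp add: field_simps)
qed

lemma cone_moment_bounds:
  assumes k: "0 \<le> k"
  shows "\<bar>cone_moment_x p k\<bar> \<le> 1" "\<bar>cone_moment_y p k\<bar> \<le> 1"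
proof -
  define Y where "Y = cone_height p k"
  have Y: "0 < Y" "Y \<le> 1" using cone_height_bounds by (auto simp: Y_def)
  have slice: "0 \<le> k * y" "k * y \<le> superellipse p y" "superellipse p y \<le> 1" if "0 \<le> y" "y \<le> Y" for y
    using cone_slice_bounds[OF k] superellipse_bounds(2)[of y] that Y unfolding Y_def[symmetric] by auto
  have bound: "\<bar>integral {0..Y} f\<bar> \<le> 1"
    if int: "f integrable_on {0..Y}" and f: "\<And>y. 0 \<le> y \<Longrightarrow> y \<le> Y \<Longrightarrow> \<bar>f y\<bar> \<le> 1" for f :: "real \<Rightarrow> real"
    using has_integral_bound_real[OF zero_le_one finite.emptyI integrable_integral[OF int]] f Y by auto
  show "\<bar>cone_moment_x p k\<bar> \<le> 1"
    unfolding cone_moment_x_def Y_def[symmetric]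
  proof (rule bound)
    fix y assume y: "0 \<le> y" "y \<le> Y"
    have "(k * y)\<^sup>2 \<le> (superellipse p y)\<^sup>2" "(superellipse p y)\<^sup>2 \<le> 1\<^sup>2"
      using slice[OF y] by (intro power_mono; linarith)+
    moreover have "0 \<le> (k * y)\<^sup>2" by simp
    moreover have "\<bar>(a - b) / 2\<bar> \<le> 1" if "b \<le> a" "a \<le> 1\<^sup>2" "0 \<le> b" for a b :: real
      using that by simp
    ultimately show "\<bar>((superellipse p y)\<^sup>2 - (k * y)\<^sup>2) / 2\<bar> \<le> 1" by blast
  qed (use cone_slice_integrable Y_def in auto)
  show "\<bar>cone_moment_y p k\<bar> \<le> 1"
    unfolding cone_moment_y_def Y_def[symmetric]
  proof (rule bound)
    fix y assume y: "0 \<le> y" "y \<le> Y"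
    show "\<bar>y * (superellipse p y - k * y)\<bar> \<le> 1"
      unfolding abs_mult using slice[OF y] y Y mult_mono[of "\<bar>y\<bar>" 1 "\<bar>superellipse p y - k * y\<bar>" 1] by auto
  qed (use cone_slice_integrable Y_def in auto)
qed

lemma primitive_cone_moments:
  assumes "0 < \<epsilon>"
  shows "\<exists>X0>0. \<forall>X\<ge>X0. \<forall>k\<ge>0.
    \<bar>(\<Sum>(a, b)\<in>primitive_cone X k. real a) / X ^ 3 - 6 / pi\<^sup>2 * cone_moment_x p k\<bar> \<le> \<epsilon> \<and>
    \<bar>(\<Sum>(a, b)\<in>primitive_cone X k. real b) / X ^ 3 - 6 / pi\<^sup>2 * cone_moment_y p k\<bar> \<le> \<epsilon>"
proof -
  have "\<exists>X0>0. \<forall>X\<ge>X0. \<forall>k\<in>{0..}.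
    \<bar>(\<Sum>(a, b)\<in>primitive_cone X k. real a) / X ^ 3 - 6 / pi\<^sup>2 * cone_moment_x p k\<bar> \<le> \<epsilon>"
    by (rule primitive_cone_asymptotics[where M = 1 and C = 4])
      (use assms cone_moment_bounds lattice_cone_moment_x in \<open>auto simp: algebra_simps\<close>)
  moreover have "\<exists>X0>0. \<forall>X\<ge>X0. \<forall>k\<in>{0..}.
    \<bar>(\<Sum>(a, b)\<in>primitive_cone X k. real b) / X ^ 3 - 6 / pi\<^sup>2 * cone_moment_y p k\<bar> \<le> \<epsilon>"
    by (rule primitive_cone_asymptotics[where M = 1 and C = 4])
      (use assms cone_moment_bounds lattice_cone_moment_y in \<open>auto simp: algebra_simps\<close>)
  ultimately obtain X1 X2 where "0 < X1" "0 < X2"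
    "\<forall>X\<ge>X1. \<forall>k\<in>{0..}. \<bar>(\<Sum>(a, b)\<in>primitive_cone X k. real a) / X ^ 3 - 6 / pi\<^sup>2 * cone_moment_x p k\<bar> \<le> \<epsilon>"
    "\<forall>X\<ge>X2. \<forall>k\<in>{0..}. \<bar>(\<Sum>(a, b)\<in>primitive_cone X k. real b) / X ^ 3 - 6 / pi\<^sup>2 * cone_moment_y p k\<bar> \<le> \<epsilon>"
    by blast
  then show ?thesis by (intro exI[of _ "max X1 X2"]) auto
qed

end

section \<open>The scaled polygons\<close>

lemma coprime_parallel_int:
  fixes a b c d :: int
  assumes "coprime a b" "coprime c d" "a * d = b * c"
  shows "(c = a \<and> d = b) \<or> (c = - a \<and> d = - b)"
proof -
  have "a dvd c" using assms by (metis coprime_dvd_mult_right_iff dvd_triv_left)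
  moreover have "c dvd a" using assms by (metis coprime_dvd_mult_left_iff dvd_triv_right)
  ultimately have "\<bar>c\<bar> = \<bar>a\<bar>" using zdvd_antisym_abs by blast
  moreover have "b dvd d" using assms by (metis coprime_commute coprime_dvd_mult_right_iff dvd_triv_left)
  moreover have "d dvd b" using assms by (metis coprime_commute coprime_dvd_mult_left_iff dvd_triv_right)
  ultimately have "\<bar>c\<bar> = \<bar>a\<bar>" "\<bar>d\<bar> = \<bar>b\<bar>" using zdvd_antisym_abs by blast+
  then show ?thesis using assms(3) by (auto simp: abs_eq_iff)
qed

context positive_exponent
begin

definition jarnik_edges :: "nat \<Rightarrow> (real \<times> real) set" where
  "jarnik_edges Q = (\<lambda>(a, b). (real_of_int a, real_of_int b)) ` primitive_vectors Q (p_ball p)"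

lemma jarnik_edges_iff:
  "(x, y) \<in> jarnik_edges Q \<longleftrightarrow> (\<exists>a b. x = real_of_int a \<and> y = real_of_int b \<and> coprime a b \<and>
    \<bar>x / real Q\<bar> powr p + \<bar>y / real Q\<bar> powr p \<le> 1)"
  by (auto simp: jarnik_edges_def primitive_vectors_def p_ball_def coprime_iff_gcd_eq_1 image_iff)

lemma jarnik_edges_cases:
  assumes "e \<in> jarnik_edges Q"
  obtains a b where "e = (real_of_int a, real_of_int b)" "coprime a b"
    "\<bar>real_of_int a / real Q\<bar> powr p + \<bar>real_of_int b / real Q\<bar> powr p \<le> 1"
proof -
  obtain x y where "e = (x, y)" by (cases e)
  then show ?thesis using assms that jarnik_edges_iff[of x y Q] by blast
qed

lemma jarnik_edges_abs_le:
  assumes "0 < Q" "e \<in> jarnik_edges Q"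
  shows "\<bar>fst e\<bar> \<le> real Q" "\<bar>snd e\<bar> \<le> real Q"
proof -
  have e: "\<bar>fst e / real Q\<bar> powr p + \<bar>snd e / real Q\<bar> powr p \<le> 1"
    using jarnik_edges_iff[of "fst e" "snd e" Q] assms by auto
  have "\<bar>fst e / real Q\<bar> powr p \<le> 1" "\<bar>snd e / real Q\<bar> powr p \<le> 1"
    using e powr_ge_zero[of "\<bar>fst e / real Q\<bar>" p] powr_ge_zero[of "\<bar>snd e / real Q\<bar>" p] by linarith+
  then show "\<bar>fst e\<bar> \<le> real Q" "\<bar>snd e\<bar> \<le> real Q"
    using le_one_if_powr_le_one[of "\<bar>fst e / real Q\<bar>"] le_one_if_powr_le_one[of "\<bar>snd e / real Q\<bar>"] assms(1) by auto
qed

lemma edge_star_jarnik_edges: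
  assumes Q: "0 < Q"
  shows "edge_star (jarnik_edges Q)"
proof
  show "finite (jarnik_edges Q)"
  proof (rule finite_subset)
    show "jarnik_edges Q \<subseteq> (\<lambda>(a, b). (real_of_int a, real_of_int b)) ` ({- int Q..int Q} \<times> {- int Q..int Q})"
    proof
      fix e assume e: "e \<in> jarnik_edges Q"
      then obtain a b where ab: "e = (real_of_int a, real_of_int b)"
        by (rule jarnik_edges_cases)
      have "\<bar>real_of_int a\<bar> \<le> real Q" "\<bar>real_of_int b\<bar> \<le> real Q"
        using jarnik_edges_abs_le[OF Q e] ab by auto
      then have "a \<in> {- int Q..int Q}" "b \<in> {- int Q..int Q}" by auto
      then show "e \<in> (\<lambda>(a, b). (real_of_int a, real_of_int b)) ` ({- int Q..int Q} \<times> {- int Q..int Q})"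
        using ab by (intro image_eqI[of _ _ "(a, b)"]) auto
    qed
  qed simp
  show "(- x, y) \<in> jarnik_edges Q" if xy: "(x, y) \<in> jarnik_edges Q" for x y
  proof -
    obtain a b where "x = real_of_int a" "y = real_of_int b" "coprime a b"
      "\<bar>x / real Q\<bar> powr p + \<bar>y / real Q\<bar> powr p \<le> 1" using xy unfolding jarnik_edges_iff by blast
    then show ?thesis unfolding jarnik_edges_iff by (intro exI[of _ "- a"] exI[of _ b]) auto
  qed
  show "(x, - y) \<in> jarnik_edges Q" if xy: "(x, y) \<in> jarnik_edges Q" for x y
  proof -
    obtain a b where "x = real_of_int a" "y = real_of_int b" "coprime a b"
      "\<bar>x / real Q\<bar> powr p + \<bar>y / real Q\<bar> powr p \<le> 1" using xy unfolding jarnik_edges_iff by blast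
    then show ?thesis unfolding jarnik_edges_iff by (intro exI[of _ a] exI[of _ "- b"]) auto
  qed
  show "(y, x) \<in> jarnik_edges Q" if "(x, y) \<in> jarnik_edges Q" for x y
    using that unfolding jarnik_edges_iff by (auto simp: coprime_commute add.commute)
  show "f = e \<or> f = - e" if ef: "e \<in> jarnik_edges Q" "f \<in> jarnik_edges Q" "cross2 e f = 0" for e f
  proof -
    obtain a b where ab: "e = (real_of_int a, real_of_int b)" "coprime a b"
      using ef(1) by (rule jarnik_edges_cases)
    obtain c d where cd: "f = (real_of_int c, real_of_int d)" "coprime c d"
      using ef(2) by (rule jarnik_edges_cases)
    have "real_of_int (a * d) = real_of_int (b * c)" using ef(3) ab cd by (simp add: cross2_def)
    then have "a * d = b * c" by (simp only: of_int_eq_iff)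
    then show ?thesis using coprime_parallel_int[OF ab(2) cd(2)] ab cd by auto
  qed
  show "(0, 0) \<notin> jarnik_edges Q" by (auto simp: jarnik_edges_iff)
  have "(1 / real Q) powr p \<le> 1" using Q p by (intro powr_le_one) auto
  then show "(1, 0) \<in> jarnik_edges Q" unfolding jarnik_edges_iff
    by (intro exI[of _ 1] exI[of _ 0]) (use p in auto)
qed

lemma jarnik_cone_sum:
  fixes w :: "real \<times> real \<Rightarrow> 'b::comm_monoid_add"
  assumes Q: "0 < Q" and k: "0 \<le> k"
  shows "(\<Sum>f | f \<in> jarnik_edges Q \<and> 0 < fst f \<and> 0 < snd f \<and> k * snd f \<le> fst f. w f)
    = (\<Sum>(a, b)\<in>primitive_cone (real Q) k. w (real a, real b))"
proof (rule sum.reindex_bij_witness[of _ "\<lambda>(a, b). (real a, real b)" "\<lambda>f. (nat \<lfloor>fst f\<rfloor>, nat \<lfloor>snd f\<rfloor>)"])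
  fix f assume f: "f \<in> {f \<in> jarnik_edges Q. 0 < fst f \<and> 0 < snd f \<and> k * snd f \<le> fst f}"
  then have "f \<in> jarnik_edges Q" by simp
  then obtain a b where ab: "f = (real_of_int a, real_of_int b)" "coprime a b"
    "\<bar>real_of_int a / real Q\<bar> powr p + \<bar>real_of_int b / real Q\<bar> powr p \<le> 1"
    by (rule jarnik_edges_cases)
  have pos: "0 < a" "0 < b" using f ab by auto
  define a' b' where "a' = nat a" and "b' = nat b"
  have a': "a = int a'" "b = int b'" "0 < a'" "0 < b'" using pos by (auto simp: a'_def b'_def)
  have "coprime a' b'" using ab(2) unfolding a' by simp
  then show "(nat \<lfloor>fst f\<rfloor>, nat \<lfloor>snd f\<rfloor>) \<in> primitive_cone (real Q) k"
    using f ab a' by (simp add: primitive_cone_def lattice_cone_def)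
  show "(case (nat \<lfloor>fst f\<rfloor>, nat \<lfloor>snd f\<rfloor>) of (a, b) \<Rightarrow> (real a, real b)) = f" using ab a' by simp
  then show "(case (nat \<lfloor>fst f\<rfloor>, nat \<lfloor>snd f\<rfloor>) of (a, b) \<Rightarrow> w (real a, real b)) = w f" by simp
next
  fix v assume v: "v \<in> primitive_cone (real Q) k"
  obtain a b where ab: "v = (a, b)" by (cases v)
  then show "(nat \<lfloor>fst (case v of (a, b) \<Rightarrow> (real a, real b))\<rfloor>, nat \<lfloor>snd (case v of (a, b) \<Rightarrow> (real a, real b))\<rfloor>) = v"
    by simp
  have "(real a, real b) \<in> jarnik_edges Q" unfolding jarnik_edges_iff
    using v ab by (intro exI[of _ "int a"] exI[of _ "int b"]) (auto simp: primitive_cone_def lattice_cone_def)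
  then show "(case v of (a, b) \<Rightarrow> (real a, real b)) \<in> {f \<in> jarnik_edges Q. 0 < fst f \<and> 0 < snd f \<and> k * snd f \<le> fst f}"
    using v ab by (auto simp: primitive_cone_def lattice_cone_def)
qed

text \<open>The choice operator is discharged by \<open>exists_has_edges\<close> and the description
  operator by \<open>the_scaled_polygon\<close>.\<close>

lemma scaled_jarnik_polygon_eq:
  assumes Q: "0 < Q"
  shows "scaled_jarnik_polygon Q (p_ball p)
    = (*\<^sub>R) (1 / - snd (edge_mid (jarnik_edges Q) (1, 0))) ` zonogon (jarnik_edges Q)"
proof -
  interpret edge_star "jarnik_edges Q" using edge_star_jarnik_edges[OF Q] .
  have iff: "is_jarnik_polygon Q (p_ball p) vs \<longleftrightarrow> has_edges (jarnik_edges Q) vs" for vs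
    by (simp add: is_jarnik_polygon_def has_edges_def jarnik_edges_def)
  have "is_jarnik_polygon Q (p_ball p) (jarnik_polygon Q (p_ball p))"
    unfolding jarnik_polygon_def using exists_has_edges unfolding iff[symmetric] by (rule someI_ex)
  then show ?thesis unfolding scaled_jarnik_polygon_def Let_def iff by (rule the_scaled_polygon)
qed

end

text \<open>\<open>T\<close> and \<open>M\<close> stand for the normalized cone sum and the
  normalized divisor. The numerator of the difference is at most \<open>3 * \<eta>\<close>, and the
  denominator \<open>M * g\<close> is at least \<open>g\<^sup>2 / 2\<close>; hence the 6. The
  divisor has twice the error because it carries the additional \<open>1/2\<close>.\<close>

lemma quotient_approximation:
  fixes T M G g \<eta> :: real
  assumes T: "\<bar>T - G\<bar> \<le> \<eta>" and M: "\<bar>M - g\<bar> \<le> 2 * \<eta>" "g / 2 \<le> M"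
    and G: "\<bar>G\<bar> \<le> 1" and g: "0 < g" "g \<le> 1"
  shows "\<bar>T / M - G / g\<bar> \<le> 6 * \<eta> / g\<^sup>2"
proof -
  have pos: "0 < M" "0 < M * g" "0 \<le> \<eta>" using T M g by (auto simp: mult_pos_pos)
  have "T / M - G / g = ((T - G) * g + G * (g - M)) / (M * g)"
    using pos g by (simp add: field_simps)
  then have "\<bar>T / M - G / g\<bar> = \<bar>(T - G) * g + G * (g - M)\<bar> / (M * g)"
    using pos by (simp add: abs_divide)
  also have "\<bar>(T - G) * g + G * (g - M)\<bar> \<le> \<bar>T - G\<bar> * \<bar>g\<bar> + \<bar>G\<bar> * \<bar>M - g\<bar>"
    using abs_triangle_ineq[of "(T - G) * g" "G * (g - M)"] by (simp add: abs_mult abs_minus_commute)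
  also have "\<dots> \<le> \<eta> * 1 + 1 * (2 * \<eta>)"
    using T M G g by (intro add_mono mult_mono) auto
  finally have "\<bar>T / M - G / g\<bar> \<le> 3 * \<eta> / (M * g)" using pos by (simp add: divide_right_mono)
  also have "\<dots> \<le> 3 * \<eta> / (g / 2 * g)"
    using pos M g by (intro divide_left_mono mult_right_mono) auto
  finally show ?thesis using g by (simp add: power2_eq_square)
qed

context positive_exponent
begin

text \<open>An edge of slope \<open>l\<close> in the octant is compared with the single point
  \<open>limit_arc_point p l\<close>. The threshold depends neither on the edge nor on the point of
  it, because the moment estimates are uniform in \<open>k\<close>.\<close>

lemma octant_edge_approximation:
  assumes \<epsilon>: "0 < \<epsilon>"
  shows "\<exists>Q0::nat. \<forall>Q>Q0. \<forall>e\<in>jarnik_edges Q. 0 \<le> snd e \<longrightarrow> snd e \<le> fst e \<longrightarrow>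
    (\<forall>z\<in>zonogon_edge (jarnik_edges Q) e.
      infdist ((1 / - snd (edge_mid (jarnik_edges Q) (1, 0))) *\<^sub>R z) (limit_curve p) < \<epsilon>)"
proof -
  define c where "c = 6 / pi\<^sup>2"
  have c: "0 < c" "c \<le> 1" using pi_gt3 power_mono[of 3 pi 2] by (simp_all add: c_def field_simps)
  define g where "g = c * cone_moment_x p 0"
  have G0: "0 < cone_moment_x p 0" using Beta_facts(1) p by (simp add: cone_moment_x_zero)
  have g: "0 < g" "g \<le> 1"
    using c G0 cone_moment_bounds(1)[of 0] mult_mono[of c 1 "cone_moment_x p 0" 1] by (simp_all add: g_def)
  \<comment> \<open>The bound \<open>g / 4\<close> keeps the normalized divisor above
    \<open>g / 2\<close>; the other bound makes the quotient error
    \<open>6 * \<eta> / g\<^sup>2\<close> at most \<open>\<epsilon> / 8\<close>.\<close>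
  define \<eta> where "\<eta> = min (g / 4) (\<epsilon> * g\<^sup>2 / 48)"
  have \<eta>: "0 < \<eta>" "\<eta> \<le> g / 4" "\<eta> \<le> \<epsilon> * g\<^sup>2 / 48" using g \<epsilon> by (auto simp: \<eta>_def)
  have \<eta>\<epsilon>: "6 * \<eta> / g\<^sup>2 \<le> \<epsilon> / 8" using \<eta>(3) g by (simp add: field_simps)
  obtain X0 where X0: "\<And>X k. X0 \<le> X \<Longrightarrow> 0 \<le> k \<Longrightarrow>
      \<bar>(\<Sum>(a, b)\<in>primitive_cone X k. real a) / X ^ 3 - c * cone_moment_x p k\<bar> \<le> \<eta>"
    "\<And>X k. X0 \<le> X \<Longrightarrow> 0 \<le> k \<Longrightarrow>
      \<bar>(\<Sum>(a, b)\<in>primitive_cone X k. real b) / X ^ 3 - c * cone_moment_y p k\<bar> \<le> \<eta>"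
    using primitive_cone_moments[OF \<eta>(1)] unfolding c_def by blast
  \<comment> \<open>Beyond \<open>1 / \<eta>\<close> the extra \<open>1/2\<close> in the divisor
    costs at most \<open>\<eta>\<close>; beyond \<open>32 / (g * \<epsilon>)\<close> the ratio of
    \<open>X\<close> to the divisor is at most \<open>\<epsilon> / 16\<close>.\<close>
  define Q0 where "Q0 = nat \<lceil>max X0 (max (1 / \<eta>) (32 / (g * \<epsilon>)))\<rceil>"
  have "infdist ((1 / - snd (edge_mid (jarnik_edges Q) (1, 0))) *\<^sub>R z) (limit_curve p) < \<epsilon>"
    if Q: "Q0 < Q" and e: "e \<in> jarnik_edges Q" "0 \<le> snd e" "snd e \<le> fst e"
      and z: "z \<in> zonogon_edge (jarnik_edges Q) e" for Q e z
  proof -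
    define E where "E = jarnik_edges Q"
    have Qpos: "0 < Q" using Q by simp
    interpret edge_star E unfolding E_def using edge_star_jarnik_edges[OF Qpos] .
    define X where "X = real Q"
    have "max X0 (max (1 / \<eta>) (32 / (g * \<epsilon>))) \<le> real Q0" unfolding Q0_def by linarith
    then have X: "X0 \<le> X" "1 / \<eta> \<le> X" "32 / (g * \<epsilon>) \<le> X" "1 \<le> X" using Q by (auto simp: X_def)
    define Tx where "Tx k = (\<Sum>(a, b)\<in>primitive_cone X k. real a)" for k
    define Ty where "Ty k = (\<Sum>(a, b)\<in>primitive_cone X k. real b)" for k
    define M where "M = - snd (edge_mid E (1, 0))"
    have MT: "M = Tx 0 + 1/2"
    proof -
      have "{f \<in> E. 0 < fst f \<and> 0 < snd f} = {f \<in> E. 0 < fst f \<and> 0 < snd f \<and> 0 * snd f \<le> fst f}"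
        by auto
      then show ?thesis using jarnik_cone_sum[OF Qpos order_refl, of fst] edge_mid_unit_quadrant
        unfolding M_def E_def Tx_def X_def fst_conv by (simp only:)
    qed
    have X3: "0 < X ^ 3" "X \<le> X ^ 3" using X power_increasing[of 1 3 X] by auto
    have "\<bar>Tx 0 / X ^ 3 - g\<bar> \<le> \<eta>" using X0(1)[OF X(1), of 0] by (simp add: Tx_def g_def)
    moreover have "1 \<le> \<eta> * X ^ 3"
      using X(2) X3(2) \<eta>(1) by (simp add: field_simps) (smt (verit) mult_left_mono mult.commute)
    then have "0 \<le> 1/2 / X ^ 3" "1/2 / X ^ 3 \<le> \<eta>" using X3 by (auto simp: field_simps)
    moreover have "M / X ^ 3 = Tx 0 / X ^ 3 + 1/2 / X ^ 3" by (simp add: MT add_divide_distrib)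
    ultimately have M': "\<bar>M / X ^ 3 - g\<bar> \<le> 2 * \<eta>" by linarith
    then have gM: "g / 2 \<le> M / X ^ 3" using \<eta>(2) by linarith
    then have M: "0 < M" using g X3 by (smt (verit) divide_nonpos_pos half_gt_zero)
    have "32 \<le> X * g * \<epsilon>" using X(3) g \<epsilon> by (simp add: field_simps)
    also have "\<dots> \<le> X\<^sup>2 * g * \<epsilon>" using X g \<epsilon> by (intro mult_right_mono) (auto simp: power2_eq_square)
    finally have "32 * X \<le> X\<^sup>2 * g * \<epsilon> * X" using X by (intro mult_right_mono) auto
    also have "\<dots> = (g / 2) * X ^ 3 * (2 * \<epsilon>)" by (simp add: power2_eq_square power3_eq_cube)
    also have "(g / 2) * X ^ 3 \<le> M" using gM X3 by (simp add: field_simps)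
    finally have XM: "X / M \<le> \<epsilon> / 16" using M \<epsilon> by (simp add: field_simps)
    obtain t where t: "\<bar>t\<bar> \<le> 1/2" "z = edge_mid E e + t *\<^sub>R e"
    proof -
      obtain u where u: "0 \<le> u" "u \<le> 1"
        "z = (1 - u) *\<^sub>R (edge_mid E e - (1/2) *\<^sub>R e) + u *\<^sub>R (edge_mid E e + (1/2) *\<^sub>R e)"
        using z by (auto simp: zonogon_edge_def closed_segment_def E_def)
      have "z = edge_mid E e + (u - 1/2) *\<^sub>R e" unfolding u(3) prod_eq_iff by (simp add: field_simps)
      moreover have "\<bar>u - 1/2\<bar> \<le> 1/2" using u by linarith
      ultimately show ?thesis using that by blast
    qed
    have near: "infdist ((1 / M) *\<^sub>R z) (limit_curve p) \<le> \<bar>fst z / M - fst w\<bar> + \<bar>snd z / M - snd w\<bar>"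
      if "w \<in> limit_arc p" for w
    proof -
      have "w \<in> limit_curve p" unfolding limit_curve_def using that ident by blast
      then have "infdist ((1 / M) *\<^sub>R z) (limit_curve p) \<le> dist ((1 / M) *\<^sub>R z) w" by (rule infdist_le)
      also have "\<dots> \<le> \<bar>fst z / M - fst w\<bar> + \<bar>snd z / M - snd w\<bar>"
        using norm_Pair_le[of "fst z / M - fst w" "snd z / M - snd w"]
        by (simp add: dist_norm norm_prod_def)
      finally show ?thesis .
    qed
    have unit_mid: "fst (edge_mid E (1, 0)) = 0" "snd (edge_mid E (1, 0)) = - M"
      using edge_mid_unit(1) by (simp_all add: M_def)
    have "infdist ((1 / M) *\<^sub>R z) (limit_curve p) < \<epsilon>"
    proof (cases "snd e = 0")
      case True
      then have "e = (1, 0) \<or> e = - (1, 0)" using parallel[OF unit_E, of e] e by (simp add: cross2_def E_def)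
      then have e10: "e = (1, 0)" using e(3) True by auto
      \<comment> \<open>Since \<open>0 powr p = 0\<close>, the argument \<open>m\<close> is 0 and
        both incomplete beta integrals run over a single point.\<close>
      have "limit_arc_point p 0 = (0, - 1)"
        by (simp add: limit_arc_point_def regularized_beta_def incomplete_beta_def)
      then have "(0, - 1) \<in> limit_arc p" by (auto simp: limit_arc_def image_iff intro!: bexI[of _ 0])
      from near[OF this] have "infdist ((1 / M) *\<^sub>R z) (limit_curve p) \<le> \<bar>t / M\<bar>"
        using M by (simp add: t(2) e10 unit_mid)
      also have "\<dots> \<le> X / M" using t(1) X M by (simp add: abs_divide divide_right_mono)
      finally show ?thesis using XM \<epsilon> by linarith
    next
      case False
      \<comment> \<open>Its reciprocal is the slope of \<open>e\<close>, which lies between 0 and 1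
        in this octant and serves as the parameter on the arc.\<close>
      define k where "k = fst e / snd e"
      have s: "0 < snd e" using False e by simp
      have f: "0 < fst e" using s e by linarith
      have k: "0 \<le> k" "1 / k = snd e / fst e" using s f by (simp_all add: k_def)
      have "{f \<in> E. 0 < snd f \<and> snd f * fst e \<le> fst f * snd e}
          = {f \<in> E. 0 < fst f \<and> 0 < snd f \<and> k * snd f \<le> fst f}"
      proof (rule Collect_cong, rule conj_cong[OF refl])
        fix h :: "real \<times> real"
        have "snd h * fst e \<le> fst h * snd e \<longleftrightarrow> k * snd h \<le> fst h" using s by (simp add: k_def field_simps)
        moreover have "0 < fst h" if "0 < snd h" "snd h * fst e \<le> fst h * snd e"
          using that mult_pos_pos[OF that(1) f] s by (smt (verit) mult_nonpos_nonneg)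
        ultimately show "(0 < snd h \<and> snd h * fst e \<le> fst h * snd e) = (0 < fst h \<and> 0 < snd h \<and> k * snd h \<le> fst h)"
          by blast
      qed
      then have "edge_mid E e - edge_mid E (1, 0)
          = (\<Sum>f | f \<in> E \<and> 0 < fst f \<and> 0 < snd f \<and> k * snd f \<le> fst f. f) + (1/2) *\<^sub>R (1, 0) - (1/2) *\<^sub>R e"
        using edge_mid_diff_unit[of e] e s by (simp add: E_def)
      then have "edge_mid E e = edge_mid E (1, 0)
          + ((\<Sum>f | f \<in> E \<and> 0 < fst f \<and> 0 < snd f \<and> k * snd f \<le> fst f. f) + (1/2) *\<^sub>R (1, 0) - (1/2) *\<^sub>R e)"
        by (metis add_diff_cancel_left' add.commute diff_add_cancel)
      then have mid: "fst (edge_mid E e) = Tx k + 1/2 - fst e / 2" "snd (edge_mid E e) = - M + Ty k - snd e / 2"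
        using jarnik_cone_sum[OF Qpos k(1), of fst] jarnik_cone_sum[OF Qpos k(1), of snd]
        by (simp_all add: unit_mid[unfolded E_def] fst_sum snd_sum E_def Tx_def Ty_def X_def)
      have "1 / k \<in> {0..1}" using k(2) s f e by simp
      then have arc: "limit_arc_point p (1 / k) \<in> limit_arc p" by (auto simp: limit_arc_def)
      have "0 < 1 / k" using k(2) s f by simp
      then have w: "fst (limit_arc_point p (1 / k)) = c * cone_moment_x p k / g"
        "snd (limit_arc_point p (1 / k)) = c * cone_moment_y p k / g - 1"
        using limit_arc_point_eq[of "1 / k"] c by (simp_all add: g_def)
      have le1: "\<bar>c * cone_moment_x p k\<bar> \<le> 1" "\<bar>c * cone_moment_y p k\<bar> \<le> 1"
        using cone_moment_bounds[OF k(1)] c mult_mono[of "\<bar>c\<bar>" 1 "\<bar>cone_moment_x p k\<bar>" 1]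
          mult_mono[of "\<bar>c\<bar>" 1 "\<bar>cone_moment_y p k\<bar>" 1] by (simp_all add: abs_mult)
      have "\<bar>(Tx k / X ^ 3) / (M / X ^ 3) - c * cone_moment_x p k / g\<bar> \<le> 6 * \<eta> / g\<^sup>2"
        "\<bar>(Ty k / X ^ 3) / (M / X ^ 3) - c * cone_moment_y p k / g\<bar> \<le> 6 * \<eta> / g\<^sup>2"
        using quotient_approximation[OF X0(1)[OF X(1) k(1)] M' gM le1(1) g]
          quotient_approximation[OF X0(2)[OF X(1) k(1)] M' gM le1(2) g] unfolding Tx_def Ty_def by blast+
      then have main: "\<bar>Tx k / M - c * cone_moment_x p k / g\<bar> \<le> \<epsilon> / 8"
        "\<bar>Ty k / M - c * cone_moment_y p k / g\<bar> \<le> \<epsilon> / 8" using \<eta>\<epsilon> X3 by auto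
      \<comment> \<open>The half-edge corrections and the offset \<open>t\<close> along the edge
        amount to at most \<open>2 * X\<close> per coordinate, against a divisor of order
        \<open>X ^ 3\<close>. Each coordinate is then off by at most \<open>\<epsilon> / 4\<close>,
        and their sum by at most \<open>\<epsilon> / 2\<close>.\<close>
      have eX: "\<bar>fst e\<bar> \<le> X" "\<bar>snd e\<bar> \<le> X"
        using jarnik_edges_abs_le[OF Qpos, of e] e by (auto simp: X_def)
      have te: "\<bar>t * fst e\<bar> \<le> X / 2" "\<bar>t * snd e\<bar> \<le> X / 2"
        unfolding abs_mult using mult_mono[OF t(1) eX(1)] mult_mono[OF t(1) eX(2)] by simp_all
      have "\<bar>(1/2 - fst e / 2 + t * fst e) / M\<bar> \<le> 2 * X / M" "\<bar>(- snd e / 2 + t * snd e) / M\<bar> \<le> 2 * X / M"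
        unfolding abs_divide using te eX X(4) M by (auto intro!: divide_right_mono)
      moreover have "fst z / M = Tx k / M + (1/2 - fst e / 2 + t * fst e) / M"
        by (simp add: t(2) mid add_divide_distrib diff_divide_distrib)
      moreover have "snd z / M = Ty k / M - 1 + (- snd e / 2 + t * snd e) / M"
        using M by (simp add: t(2) mid add_divide_distrib diff_divide_distrib)
      moreover have "2 * X / M \<le> \<epsilon> / 8" using XM by (simp add: mult.commute)
      ultimately show ?thesis using near[OF arc] main \<epsilon> unfolding w by linarith
    qed
    then show ?thesis by (simp add: M_def E_def)
  qed
  then show ?thesis by blast
qed

end

theorem theorem5:
  fixes p :: real
  assumes "p > 0"
  shows "\<forall>\<epsilon>::real>0. \<exists>Q0::nat. \<forall>Q>Q0.
           \<forall>x\<in>scaled_jarnik_polygon Q (p_ball p). infdist x (limit_curve p) < \<epsilon>"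
proof (intro allI impI)
  fix \<epsilon> :: real
  assume \<epsilon>: "0 < \<epsilon>"
  interpret positive_exponent p using assms by unfold_locales
  obtain Q0 where Q0: "\<And>Q e z. \<lbrakk>Q0 < Q; e \<in> jarnik_edges Q; 0 \<le> snd e; snd e \<le> fst e;
      z \<in> zonogon_edge (jarnik_edges Q) e\<rbrakk> \<Longrightarrow>
      infdist ((1 / - snd (edge_mid (jarnik_edges Q) (1, 0))) *\<^sub>R z) (limit_curve p) < \<epsilon>"
    using octant_edge_approximation[OF \<epsilon>] by blast
  have "infdist x (limit_curve p) < \<epsilon>" if Q: "Q0 < Q" and x: "x \<in> scaled_jarnik_polygon Q (p_ball p)" for Q x
  proof -
    define E where "E = jarnik_edges Q"
    define r where "r = 1 / - snd (edge_mid E (1, 0))"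
    interpret edge_star E unfolding E_def using Q by (intro edge_star_jarnik_edges) simp
    \<comment> \<open>The bound for a whole edge is the property given to
      \<open>octant_induct\<close>: a reflection carries zonogon edges to zonogon edges, commutes
      with the scaling by \<open>r\<close>, and does not increase the distance to the limit
      curve.\<close>
    have close: "\<forall>z\<in>zonogon_edge E e. infdist (r *\<^sub>R z) (limit_curve p) < \<epsilon>" if "e \<in> E" for e
      using that
    proof (rule octant_induct[rotated -1])
      fix e assume IH: "\<forall>z\<in>zonogon_edge E e. infdist (r *\<^sub>R z) (limit_curve p) < \<epsilon>"
      show "\<forall>z\<in>zonogon_edge E (fst e, - snd e). infdist (r *\<^sub>R z) (limit_curve p) < \<epsilon>"
        unfolding flip_x_zonogon(2)[symmetric]
        using IH infdist_limit_curve(1)[of "r *\<^sub>R _" p] by (fastforce intro: le_less_trans)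
      show "\<forall>z\<in>zonogon_edge E (- fst e, snd e). infdist (r *\<^sub>R z) (limit_curve p) < \<epsilon>"
        unfolding flip_y_zonogon(1)[symmetric]
        using IH infdist_limit_curve(2)[of "r *\<^sub>R _" p] by (fastforce intro: le_less_trans)
      show "\<forall>z\<in>zonogon_edge E (- snd e, - fst e). infdist (r *\<^sub>R z) (limit_curve p) < \<epsilon>"
        unfolding flip_diag_zonogon(1)[symmetric]
        using IH infdist_limit_curve(3)[of "r *\<^sub>R _" p] by (fastforce intro: le_less_trans)
    qed (use Q0[OF Q] in \<open>auto simp: E_def r_def\<close>)
    have "0 < Q" using Q by simp
    then obtain e z where "e \<in> E" "z \<in> zonogon_edge E e" "x = r *\<^sub>R z"
      using x by (auto simp: scaled_jarnik_polygon_eq zonogon_def E_def r_def)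
    then show ?thesis using close by blast
  qed
  then show "\<exists>Q0::nat. \<forall>Q>Q0. \<forall>x\<in>scaled_jarnik_polygon Q (p_ball p). infdist x (limit_curve p) < \<epsilon>"
    by blast
qed

end
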